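(* Let $G$ be a $2$-connected cubic graph with a Kotzig-frame $F$. Let $\tilde K$ be the set of K-vertices and $\tilde C$ the set of C-vertices of $G_F$. Then $G$ has a $6$-cycle double cover if one of the following holds: (i) $\tilde K$ is an independent set in $G_F$ and $G_F-\tilde K$ is connected; (ii) every vertex of $\tilde K$ is adjacent to a vertex of $\tilde C$ and $G_F-\tilde K$ is connected; (iii) there is a subset $C^*\subseteq \tilde C$ such that the induced subgraph $G_F[C^*]$ is connected and $\tilde K\subseteq N(C^* )$, where $N(C^* )$ is the set of neighbors of vertices of $C^*$ in $G_F$.
   Context: All graphs are finite and loopless; parallel edges are allowed. A cycle is a connected $2$-regular graph (two parallel edges form a cycle). A cycle double cover (CDC) of $G$ is a set $S$ of cycles of $G$ such that every edge of $G$ lies in precisely two cycles of $S$. For a cubic graph, a $k$-cycle double cover ($k$-CDC) is a CDC that can be partitioned into $k$ (possibly empty) subsets, each consisting of pairwise edge-disjoint cycles. A Kotzig graph is a cubic graph admitting a proper $3$-edge-coloring in which each cycle whose edges carry at most two colors is hamiltonian. A subdivision of a graph $K$ is obtained from $K$ by replacing at least one edge $e=vw$ by a $vw$-path of length at least $2$. Let $G$ be a $2$-connected cubic graph. A Kotzig-frame of $G$ is a spanning subgraph $F$ of $G$ such that (i) every component of $F$ has an even number of vertices, and (ii) every component of $F$ is either a cycle (a C-component) or a subdivision of a Kotzig graph (a K-component). $G_F$ is the graph obtained from $G$ by contracting every component of $F$ to a distinct vertex and deleting all resulting loops. A vertex of $G_F$ is a C-vertex if it corresponds to a C-component and a K-vertex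 if it corresponds to a K-component. *)

theory Defs
  imports Main "HOL-Library.Disjoint_Sets"
begin

text \<open>Finite loopless graphs with parallel edges allowed. Edges are named objects;
  \<open>mends\<close> gives the two-element set of end vertices of an edge.\<close>

record ('v, 'e) mgraph =
  mverts :: "'v set"
  medges :: "'e set"
  mends  :: "'e \<Rightarrow> 'v set"

definition multigraph :: "('v, 'e) mgraph \<Rightarrow> bool" where
  "multigraph G \<longleftrightarrow> finite (mverts G) \<and> finite (medges G) \<and>
     (\<forall>e\<in>medges G. mends G e \<subseteq> mverts G \<and> card (mends G e) = 2)"

text \<open>The incidence functions are required to agree everywhere, not just on \<open>medges H\<close>, so that
  a subgraph of \<open>G\<close> is determined by its vertex and edge sets. In particular a set of cycles
  of \<open>G\<close> cannot contain the same cycle twice.\<close>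

definition mg_subgraph :: "('v, 'e) mgraph \<Rightarrow> ('v, 'e) mgraph \<Rightarrow> bool" where
  "mg_subgraph H G \<longleftrightarrow> multigraph H \<and> mverts H \<subseteq> mverts G \<and> medges H \<subseteq> medges G \<and>
     mends H = mends G"

definition mg_induced :: "('v, 'e) mgraph \<Rightarrow> 'v set \<Rightarrow> ('v, 'e) mgraph" where
  "mg_induced G X = \<lparr>mverts = mverts G \<inter> X,
     medges = {e \<in> medges G. mends G e \<subseteq> X}, mends = mends G\<rparr>"

definition mg_delete :: "('v, 'e) mgraph \<Rightarrow> 'v set \<Rightarrow> ('v, 'e) mgraph" where
  "mg_delete G X = mg_induced G (mverts G - X)"

definition mg_adjacent :: "('v, 'e) mgraph \<Rightarrow> 'v \<Rightarrow> 'v \<Rightarrow> bool" where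
  "mg_adjacent G u v \<longleftrightarrow> (\<exists>e\<in>medges G. mends G e = {u, v})"

definition mg_neighbors :: "('v, 'e) mgraph \<Rightarrow> 'v set \<Rightarrow> 'v set" where
  "mg_neighbors G X = {v \<in> mverts G. \<exists>u\<in>X. mg_adjacent G u v}"

definition mg_independent :: "('v, 'e) mgraph \<Rightarrow> 'v set \<Rightarrow> bool" where
  "mg_independent G X \<longleftrightarrow> X \<subseteq> mverts G \<and> (\<forall>u\<in>X. \<forall>v\<in>X. \<not> mg_adjacent G u v)"

text \<open>No loops occur, so the degree is the number of incident edges.\<close>

definition mg_degree :: "('v, 'e) mgraph \<Rightarrow> 'v \<Rightarrow> nat" where
  "mg_degree G v = card {e \<in> medges G. v \<in> mends G e}"

definition mg_regular :: "nat \<Rightarrow> ('v, 'e) mgraph \<Rightarrow> bool" where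
  "mg_regular d G \<longleftrightarrow> (\<forall>v\<in>mverts G. mg_degree G v = d)"

definition cubic_graph :: "('v, 'e) mgraph \<Rightarrow> bool" where
  "cubic_graph G \<longleftrightarrow> multigraph G \<and> mg_regular 3 G"

text \<open>The graph without vertices is not connected.\<close>

definition mg_connected :: "('v, 'e) mgraph \<Rightarrow> bool" where
  "mg_connected G \<longleftrightarrow> mverts G \<noteq> {} \<and>
     (\<forall>u\<in>mverts G. \<forall>v\<in>mverts G. (mg_adjacent G)\<^sup>*\<^sup>* u v)"

text \<open>Two vertices suffice here, so that the cubic graph consisting of three parallel edges is
  2-connected, as is usual when parallel edges are allowed. (A single edge on two vertices
  passes as well, but it is not cubic.)\<close>

definition two_connected :: "('v, 'e) mgraph \<Rightarrow> bool" where
  "two_connected G \<longleftrightarrow> 2 \<le> card (mverts G) \<and> mg_connected G \<and>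
     (\<forall>v\<in>mverts G. mg_connected (mg_delete G {v}))"

definition mg_components :: "('v, 'e) mgraph \<Rightarrow> ('v, 'e) mgraph set" where
  "mg_components G = {H. mg_subgraph H G \<and> mg_connected H \<and>
     (\<forall>H'. mg_subgraph H' G \<and> mg_connected H' \<and> mg_subgraph H H' \<longrightarrow> H' = H)}"

definition is_cycle :: "('v, 'e) mgraph \<Rightarrow> bool" where
  "is_cycle C \<longleftrightarrow> multigraph C \<and> mg_connected C \<and> mg_regular 2 C"

definition cycle_double_cover :: "('v, 'e) mgraph \<Rightarrow> ('v, 'e) mgraph set \<Rightarrow> bool" where
  "cycle_double_cover G S \<longleftrightarrow> (\<forall>C\<in>S. is_cycle C \<and> mg_subgraph C G) \<and>
     (\<forall>e\<in>medges G. card {C \<in> S. e \<in> medges C} = 2)"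

definition has_k_cdc :: "nat \<Rightarrow> ('v, 'e) mgraph \<Rightarrow> bool" where
  "has_k_cdc k G \<longleftrightarrow> (\<exists>S P. cycle_double_cover G S \<and>
     S = (\<Union>i<k. P i) \<and> disjoint_family_on P {..<k} \<and>
     (\<forall>i<k. pairwise (\<lambda>C D. medges C \<inter> medges D = {}) (P i)))"

definition proper_3_edge_coloring :: "('v, 'e) mgraph \<Rightarrow> ('e \<Rightarrow> nat) \<Rightarrow> bool" where
  "proper_3_edge_coloring G c \<longleftrightarrow> c ` medges G \<subseteq> {..<3} \<and>
     (\<forall>e\<in>medges G. \<forall>f\<in>medges G. e \<noteq> f \<and> mends G e \<inter> mends G f \<noteq> {} \<longrightarrow> c e \<noteq> c f)"

definition kotzig_graph :: "('v, 'e) mgraph \<Rightarrow> bool" where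
  "kotzig_graph K \<longleftrightarrow> cubic_graph K \<and>
     (\<exists>c. proper_3_edge_coloring K c \<and>
       (\<forall>C. is_cycle C \<and> mg_subgraph C K \<and> card (c ` medges C) \<le> 2 \<longrightarrow> mverts C = mverts K))"

text \<open>A path is given by its successive vertices \<open>vs\<close> and its successive edges \<open>es\<close>.\<close>

definition is_path :: "('v, 'e) mgraph \<Rightarrow> 'v list \<Rightarrow> 'e list \<Rightarrow> bool" where
  "is_path G vs es \<longleftrightarrow> distinct vs \<and> length vs = Suc (length es) \<and>
     set vs \<subseteq> mverts G \<and> set es \<subseteq> medges G \<and>
     (\<forall>i<length es. mends G (es ! i) = {vs ! i, vs ! Suc i})"

definition inner_verts :: "'v list \<Rightarrow> 'v set" where
  "inner_verts vs = set (butlast (tl vs))"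

text \<open>\<open>H\<close> arises from \<open>K\<close> by placing the vertices of \<open>K\<close> via \<open>\<phi>\<close> and putting in place of each edge
  \<open>e\<close> the path \<open>pv e\<close>, \<open>pe e\<close>; an edge that is not replaced has a path of length 1.
  At least one edge has to be replaced, so \<open>K\<close> is not a subdivision of itself.\<close>

definition subdivision_of :: "('v, 'e) mgraph \<Rightarrow> ('a, 'b) mgraph \<Rightarrow> bool" where
  "subdivision_of H K \<longleftrightarrow> multigraph H \<and> multigraph K \<and>
     (\<exists>\<phi> pv pe.
        inj_on \<phi> (mverts K) \<and>
        (\<forall>e\<in>medges K. is_path H (pv e) (pe e) \<and>
           {hd (pv e), last (pv e)} = \<phi> ` mends K e \<and>
           inner_verts (pv e) \<inter> \<phi> ` mverts K = {}) \<and>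
        (\<forall>e\<in>medges K. \<forall>f\<in>medges K. e \<noteq> f \<longrightarrow>
           inner_verts (pv e) \<inter> inner_verts (pv f) = {} \<and> set (pe e) \<inter> set (pe f) = {}) \<and>
        mverts H = \<phi> ` mverts K \<union> (\<Union>e\<in>medges K. inner_verts (pv e)) \<and>
        medges H = (\<Union>e\<in>medges K. set (pe e)) \<and>
        (\<exists>e\<in>medges K. 2 \<le> length (pe e)))"

text \<open>Taking vertices and edges of the Kotzig graph in \<^typ>\<open>nat\<close> is no restriction, as every finite
  graph is isomorphic to one of this kind.\<close>

definition subdivided_kotzig :: "('v, 'e) mgraph \<Rightarrow> bool" where
  "subdivided_kotzig H \<longleftrightarrow> (\<exists>K :: (nat, nat) mgraph. kotzig_graph K \<and> subdivision_of H K)"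

definition kotzig_frame :: "('v, 'e) mgraph \<Rightarrow> ('v, 'e) mgraph \<Rightarrow> bool" where
  "kotzig_frame G F \<longleftrightarrow> mg_subgraph F G \<and> mverts F = mverts G \<and>
     (\<forall>H\<in>mg_components F. even (card (mverts H)) \<and> (is_cycle H \<or> subdivided_kotzig H))"

text \<open>The components of \<open>F\<close> themselves serve as the vertices of the contracted graph. For \<open>F\<close>
  spanning \<open>G\<close>, an edge becomes a loop iff both its ends lie in one component; the other edges
  are all kept, including parallel ones.\<close>

definition contracted :: "('v, 'e) mgraph \<Rightarrow> ('v, 'e) mgraph \<Rightarrow> (('v, 'e) mgraph, 'e) mgraph" where
  "contracted G F = \<lparr>mverts = mg_components F,
     medges = {e \<in> medges G. \<not> (\<exists>H\<in>mg_components F. mends G e \<subseteq> mverts H)},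
     mends = (\<lambda>e. {H \<in> mg_components F. mends G e \<inter> mverts H \<noteq> {}})\<rparr>"

definition K_vertices :: "('v, 'e) mgraph \<Rightarrow> ('v, 'e) mgraph set" where
  "K_vertices F = {H \<in> mg_components F. subdivided_kotzig H}"

definition C_vertices :: "('v, 'e) mgraph \<Rightarrow> ('v, 'e) mgraph set" where
  "C_vertices F = {H \<in> mg_components F. is_cycle H}"

end

theory Submission
  imports Defs "HOL-Combinatorics.Transposition"
begin

text \<open>Why the theorem is true. Let \<open>M\<close> be the set of edges of \<open>G\<close> outside \<open>F\<close>. Colour the edges of \<open>F\<close>
  with \<open>0, 1, 2\<close>: a cycle component gets a single colour, a subdivided Kotzig graph inherits a Kotzig
  colouring, all edges of a subdivided edge getting the colour of that edge. For each colour \<open>k\<close> the edges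
  of \<open>F\<close> not coloured \<open>k\<close> form a 2-regular graph \<open>R k\<close> with at most one cycle in each component of
  \<open>F\<close>, and each edge of \<open>F\<close> lies in two of the three graphs \<open>R k\<close>.

  Suppose that \<open>M\<close> is split into classes \<open>M 0, M 1, M 2\<close> such that the edges of \<open>M k\<close> have both ends on
  \<open>R k\<close> and each cycle of \<open>R k\<close> carries an even number of these ends. The ends then cut each cycle of
  \<open>R k\<close> into segments that belong alternately to a set \<open>Z k\<close> and to its complement, and both
  \<open>Z k \<union> M k\<close> and \<open>(R k - Z k) \<union> M k\<close> have even degrees. These six edge sets cover every edge
  twice, and in a cubic graph an edge set with even degrees is a disjoint union of cycles. This is
  \<open>colour_classes_imp_6_cdc\<close>; that no cycle is obtained twice is part of
  \<open>even_edge_sets_imp_cdc\<close>.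

  It remains to split \<open>M\<close>. An edge whose ends have colours \<open>a\<close> and \<open>b\<close> may go to any class
  \<open>k \<notin> {a, b}\<close>, so there is a choice just for the edges with \<open>a = b\<close>; on the other hand the colours may
  be permuted within each component. In case (iii) colour the cycles of the connected core \<open>C'\<close> with 0,
  the remaining cycles with 1, and permute the colours of each Kotzig component so that one of its
  edges to the core ends at colour 0 on both sides. The parities are then repaired in two rounds
  (\<open>balanced_partition\<close>). First, colours 1 and 2 are exchanged in a set of components for which the
  number of edges with equal nonzero colours at their ends is as large as possible; as with a
  maximum cut, these free edges then connect the two ends of every edge without an end of colour 0,
  and a T-join of free edges makes the number of ends of \<open>M 0\<close> even in every component. Secondly, the
  edges with two ends of colour 0 connect the core and all Kotzig components, and a T-join among them
  does the same for \<open>M 1\<close>; the cycles outside the core have a single nonzero colour, and there the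
  parity of \<open>M 1\<close> is automatic. The number of ends of \<open>M 2\<close> is then even as well, because the
  components have even order and thus an even number of ends of \<open>M\<close>.

  Cases (i) and (ii) reduce to (iii) with all cycle components as the core.\<close>

section \<open>Degrees, connection and T-joins\<close>

definition edeg :: "('e \<Rightarrow> 'v set) \<Rightarrow> 'e set \<Rightarrow> 'v \<Rightarrow> nat" where
  "edeg inc X v = card {e \<in> X. v \<in> inc e}"

definition linked :: "('e \<Rightarrow> 'v set) \<Rightarrow> 'e set \<Rightarrow> 'v \<Rightarrow> 'v \<Rightarrow> bool" where
  "linked inc X = (\<lambda>u v. \<exists>e\<in>X. inc e = {u, v})\<^sup>*\<^sup>*"

lemma linked_refl [simp]: "linked inc X u u"
  by (simp add: linked_def)

lemma linked_trans [trans]: "linked inc X u v \<Longrightarrow> linked inc X v w \<Longrightarrow> linked inc X u w"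
  unfolding linked_def by (rule rtranclp_trans)

lemma linked_edge: "e \<in> X \<Longrightarrow> inc e = {u, v} \<Longrightarrow> linked inc X u v"
  unfolding linked_def by blast

lemma linked_sym:
  assumes "linked inc X u v" shows "linked inc X v u"
proof -
  have "symp (\<lambda>u v. \<exists>e\<in>X. inc e = {u, v})\<^sup>*\<^sup>*"
    by (intro symp_rtranclp sympI) (auto simp: insert_commute)
  from sympD[OF this] assms show ?thesis
    unfolding linked_def by blast
qed

lemma linked_mono: "linked inc X u v \<Longrightarrow> X \<subseteq> Y \<Longrightarrow> linked inc Y u v"
  unfolding linked_def by (erule rtranclp_mono[THEN predicate2D, rotated]) auto

lemma linked_edge_ends:
  assumes "e \<in> X" "card (inc e) = 2" "u \<in> inc e" "v \<in> inc e"
  shows "linked inc X u v"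
proof (cases "u = v")
  case False
  then have "inc e = {u, v}"
    using assms by (auto simp: card_2_iff)
  then show ?thesis using assms linked_edge by metis
qed simp

lemma linked_closed:
  assumes "linked inc X u v" "u \<in> Q"
    and "\<And>e. e \<in> X \<Longrightarrow> inc e \<subseteq> Q \<or> inc e \<inter> Q = {}"
  shows "v \<in> Q"
  using assms(1,2) unfolding linked_def
proof (induction rule: rtranclp_induct)
  case (step y z)
  then show ?case using assms(3) by fastforce
qed

lemma edge_within_linked_class:
  assumes "\<And>e. e \<in> X \<Longrightarrow> card (inc e) = 2" "\<And>e. e \<in> X \<Longrightarrow> inc e \<subseteq> V" "e \<in> X"
  shows "inc e \<subseteq> {w \<in> V. linked inc X u w} \<or> inc e \<inter> {w \<in> V. linked inc X u w} = {}"
proof -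
  have "linked inc X u b" if "linked inc X u a" "a \<in> inc e" "b \<in> inc e" for a b
    using linked_trans[OF that(1) linked_edge_ends] assms(1,3) that(2,3) by metis
  then show ?thesis using assms(2)[OF assms(3)] by blast
qed

lemma edeg_Un_disjoint:
  "finite X \<Longrightarrow> finite Y \<Longrightarrow> X \<inter> Y = {} \<Longrightarrow> edeg inc (X \<union> Y) v = edeg inc X v + edeg inc Y v"
  unfolding edeg_def by (subst card_Un_disjoint[symmetric]) (auto intro: arg_cong[where f=card])

lemma edeg_eq_0_iff: "finite X \<Longrightarrow> edeg inc X v = 0 \<longleftrightarrow> (\<forall>e\<in>X. v \<notin> inc e)"
  by (auto simp: edeg_def)

lemma edeg_Diff:
  assumes "finite Y" "X \<subseteq> Y"
  shows "edeg inc X v + edeg inc (Y - X) v = edeg inc Y v"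
  using edeg_Un_disjoint[of X "Y - X" inc v] assms finite_subset[of X Y]
  by (simp add: Un_absorb1)

lemma even_edeg_sym_diff:
  assumes "finite X" "finite Y"
  shows "even (edeg inc (X - Y \<union> (Y - X)) v) \<longleftrightarrow> even (edeg inc X v + edeg inc Y v)"
proof -
  have "edeg inc (X - Y \<union> (Y - X)) v = edeg inc (X - Y) v + edeg inc (Y - X) v"
    using assms by (intro edeg_Un_disjoint) auto
  moreover have "edeg inc (X \<inter> Y) v + edeg inc (X - Y) v = edeg inc X v"
    using edeg_Diff[of X "X \<inter> Y" inc v] assms by (simp add: Diff_Int)
  moreover have "edeg inc (X \<inter> Y) v + edeg inc (Y - X) v = edeg inc Y v"
    using edeg_Diff[of Y "X \<inter> Y" inc v] assms by (simp add: Diff_Int)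
  ultimately have "edeg inc X v + edeg inc Y v = edeg inc (X - Y \<union> (Y - X)) v + 2 * edeg inc (X \<inter> Y) v"
    by linarith
  then show ?thesis by simp
qed

lemma sum_edeg:
  assumes "finite X" "finite Q"
  shows "(\<Sum>v\<in>Q. edeg inc X v) = (\<Sum>e\<in>X. card (inc e \<inter> Q))"
proof -
  have "(\<Sum>v\<in>Q. edeg inc X v) = (\<Sum>v\<in>Q. \<Sum>e\<in>X. if v \<in> inc e then 1 else 0)"
    using assms by (simp add: edeg_def sum.If_cases Int_def)
  also have "\<dots> = (\<Sum>e\<in>X. \<Sum>v\<in>Q. if v \<in> inc e then 1 else 0)"
    by (rule sum.swap)
  also have "\<dots> = (\<Sum>e\<in>X. card (inc e \<inter> Q))"
    using assms by (simp add: sum.If_cases Int_def conj_commute)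
  finally show ?thesis .
qed

lemma handshake:
  assumes "finite X" "finite Q" "\<And>e. e \<in> X \<Longrightarrow> card (inc e) = 2"
    and "\<And>e. e \<in> X \<Longrightarrow> inc e \<subseteq> Q \<or> inc e \<inter> Q = {}"
  shows "even (\<Sum>v\<in>Q. edeg inc X v)"
proof -
  have "even (card (inc e \<inter> Q))" if "e \<in> X" for e
    using assms(3,4)[OF that] by (auto simp: Int_absorb2)
  then show ?thesis
    unfolding sum_edeg[OF assms(1,2)] by (intro dvd_sum) auto
qed

text \<open>Adding up (modulo 2) the edges of a walk from \<open>u\<close> to \<open>w\<close>
  leaves odd degree at most at \<open>u\<close> and \<open>w\<close>.\<close>

lemma linked_imp_join:
  assumes "linked inc X u w" "finite X" "\<And>e. e \<in> X \<Longrightarrow> card (inc e) = 2"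
  shows "\<exists>Y\<subseteq>X. \<forall>v. even (edeg inc Y v) \<longleftrightarrow> (v = u \<longleftrightarrow> v = w)"
  using assms(1) unfolding linked_def
proof (induction rule: rtranclp_induct)
  case base
  then show ?case by (intro exI[of _ "{}"]) (simp add: edeg_def)
next
  case (step y z)
  then obtain Y e where Y: "Y \<subseteq> X" "\<And>v. even (edeg inc Y v) \<longleftrightarrow> (v = u \<longleftrightarrow> v = y)"
    and e: "e \<in> X" "inc e = {y, z}" by blast
  have "y \<noteq> z" using assms(3)[OF e(1)] e(2) by auto
  have "finite Y" using Y assms finite_subset by blast
  have "edeg inc {e} v = (if v = y \<or> v = z then 1 else 0)" for v
    using e(2) by (auto simp: edeg_def Collect_conv_if conj_commute)
  then have "even (edeg inc (Y - {e} \<union> ({e} - Y)) v) \<longleftrightarrow> (v = u \<longleftrightarrow> v = z)" for v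
    using even_edeg_sym_diff[OF \<open>finite Y\<close>, of "{e}" inc v] Y(2)[of v] \<open>y \<noteq> z\<close> by auto
  then show ?case
    using Y(1) e(1) by (intro exI[of _ "Y - {e} \<union> ({e} - Y)"]) blast
qed

text \<open>A T-join, with \<open>T\<close> the set of vertices at which \<open>f\<close> is odd.
  If \<open>Z\<close> violates the fewest vertices, it violates none: the violated vertices of a
  connected class are even in number, and toggling \<open>Z\<close> along a path between two of
  them would repair both.\<close>

lemma T_join_exists:
  fixes f :: "'v \<Rightarrow> nat"
  assumes X: "finite X" "\<And>e. e \<in> X \<Longrightarrow> card (inc e) = 2" "\<And>e. e \<in> X \<Longrightarrow> inc e \<subseteq> V"
    and V: "finite V"
    and f: "\<And>u. u \<in> V \<Longrightarrow> even (\<Sum>v\<in>{v \<in> V. linked inc X u v}. f v)"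
  shows "\<exists>Z\<subseteq>X. \<forall>v\<in>V. even (edeg inc Z v + f v)"
proof -
  define bad where "bad Z = {v \<in> V. odd (edeg inc Z v + f v)}" for Z
  have "\<exists>Z. Z \<subseteq> X" by blast
  then obtain Z where Z: "Z \<subseteq> X" and least: "\<And>Z'. Z' \<subseteq> X \<Longrightarrow> card (bad Z) \<le> card (bad Z')"
    using ex_has_least_nat[of "\<lambda>Z. Z \<subseteq> X" _ "\<lambda>Z. card (bad Z)"] by metis
  have finZ: "finite Z" using Z X(1) finite_subset by blast
  have "bad Z = {}"
  proof (rule ccontr)
    assume "bad Z \<noteq> {}"
    then obtain u where u: "u \<in> V" "odd (edeg inc Z u + f u)" by (auto simp: bad_def)
    define U where "U = {v \<in> V. linked inc X u v}"
    have finU: "finite U" using V by (simp add: U_def)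
    have "even (\<Sum>v\<in>U. edeg inc Z v)"
      using Z X edge_within_linked_class[of X inc V _ u] finZ finU
      unfolding U_def by (intro handshake) blast+
    then have "even (\<Sum>v\<in>U. edeg inc Z v + f v)"
      using f[OF u(1)] by (simp add: sum.distrib U_def)
    then have "even (card {v \<in> U. odd (edeg inc Z v + f v)})"
      using even_sum_iff[OF finU, of "\<lambda>v. edeg inc Z v + f v"] by simp
    then have "card {v \<in> U. odd (edeg inc Z v + f v)} \<noteq> card {u}" by fastforce
    then have "{v \<in> U. odd (edeg inc Z v + f v)} \<noteq> {u}" by metis
    moreover have uU: "u \<in> {v \<in> U. odd (edeg inc Z v + f v)}"
      using u by (simp add: U_def)
    ultimately have "\<exists>w\<in>{v \<in> U. odd (edeg inc Z v + f v)}. w \<noteq> u" by blast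
    then obtain w where w: "w \<in> U" "odd (edeg inc Z w + f w)" "w \<noteq> u" by blast
    obtain Y where Y: "Y \<subseteq> X" "\<And>v. even (edeg inc Y v) \<longleftrightarrow> (v = u \<longleftrightarrow> v = w)"
      using linked_imp_join[of inc X u w] w(1) X(1,2) U_def by blast
    have finY: "finite Y" using Y X(1) finite_subset by blast
    define Z' where "Z' = Z - Y \<union> (Y - Z)"
    have parity: "even (edeg inc Z' v) \<longleftrightarrow> even (edeg inc Z v + edeg inc Y v)" for v
      unfolding Z'_def by (rule even_edeg_sym_diff[OF finZ finY])
    have "v \<in> bad Z" if "v \<in> bad Z'" for v
      using that parity[of v] Y(2)[of v] w(2,3) u(2) unfolding bad_def
      by (cases "v = u"; cases "v = w") auto
    moreover have "u \<in> bad Z" "u \<notin> bad Z'"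
      using u parity[of u] Y(2)[of u] w(3) by (auto simp: bad_def)
    moreover have "finite (bad Z)" using V by (simp add: bad_def)
    ultimately have "card (bad Z') < card (bad Z)"
      by (intro psubset_card_mono) auto
    moreover have "Z' \<subseteq> X" using Z Y(1) Z'_def by blast
    ultimately show False using least[of Z'] by simp
  qed
  then show ?thesis using Z unfolding bad_def by blast
qed

section \<open>Components and cycle decompositions\<close>

lemma multigraph_edge:
  assumes "multigraph G" "e \<in> medges G"
  shows "card (mends G e) = 2" "mends G e \<subseteq> mverts G" "finite (mends G e)" "mends G e \<noteq> {}"
  using assms card_gt_0_iff[of "mends G e"] by (auto simp: multigraph_def)

lemma mg_degree_eq_edeg: "mg_degree G v = edeg (mends G) (medges G) v"
  by (simp add: mg_degree_def edeg_def)

lemma mg_connected_iff_linked: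
  "mg_connected G \<longleftrightarrow> mverts G \<noteq> {} \<and>
     (\<forall>u\<in>mverts G. \<forall>v\<in>mverts G. linked (mends G) (medges G) u v)"
  by (simp add: mg_connected_def linked_def mg_adjacent_def[abs_def])

definition component :: "('v, 'e) mgraph \<Rightarrow> 'v \<Rightarrow> ('v, 'e) mgraph" where
  "component G v = mg_induced G {w. linked (mends G) (medges G) v w}"

lemma component_simps:
  "mverts (component G v) = {w \<in> mverts G. linked (mends G) (medges G) v w}"
  "medges (component G v) =
     {e \<in> medges G. mends G e \<subseteq> {w. linked (mends G) (medges G) v w}}"
  "mends (component G v) = mends G"
  by (auto simp: component_def mg_induced_def)

lemma in_component_self: "v \<in> mverts G \<Longrightarrow> v \<in> mverts (component G v)"
  by (simp add: component_simps)

lemma component_subgraph: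
  assumes "multigraph G" shows "mg_subgraph (component G v) G"
  using assms unfolding mg_subgraph_def multigraph_def by (auto simp: component_simps)

lemma component_edge:
  assumes "multigraph G" "e \<in> medges G" "u \<in> mends G e" "u \<in> mverts (component G v)"
  shows "e \<in> medges (component G v)"
proof -
  have "linked (mends G) (medges G) v w" if "w \<in> mends G e" for w
    using assms(4) linked_edge_ends[of e "medges G" "mends G" u w] multigraph_edge[OF assms(1,2)]
      assms(2,3) that linked_trans[of "mends G" "medges G" v u w] by (auto simp: component_simps)
  then show ?thesis using assms(2) by (auto simp: component_simps)
qed

lemma edeg_component:
  assumes "multigraph G" "u \<in> mverts (component G v)"
  shows "edeg (mends G) (medges (component G v)) u = edeg (mends G) (medges G) u"
proof -
  have "{e \<in> medges (component G v). u \<in> mends G e} = {e \<in> medges G. u \<in> mends G e}"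
    using component_edge[OF assms(1) _ _ assms(2)] by (auto simp: component_simps)
  then show ?thesis by (simp add: edeg_def)
qed

lemma component_eq:
  assumes "u \<in> mverts (component G v)"
  shows "component G u = component G v"
proof -
  have "linked (mends G) (medges G) u w \<longleftrightarrow> linked (mends G) (medges G) v w" for w
    using assms linked_sym[of "mends G" "medges G" v u] linked_trans[of "mends G" "medges G"]
    by (auto simp: component_simps)
  then show ?thesis by (simp add: component_def)
qed

lemma linked_in_component:
  assumes "multigraph G" "linked (mends G) (medges G) v w"
  shows "linked (mends G) (medges (component G v)) v w"
  using assms(2) unfolding linked_def
proof (induction rule: rtranclp_induct)
  case (step y z)
  then obtain e where e: "e \<in> medges G" "mends G e = {y, z}" by blast
  have "y \<in> mverts (component G v)"
    using step(1) multigraph_edge(2)[OF assms(1) e(1)] e(2)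
    by (auto simp: component_simps linked_def)
  then have "e \<in> medges (component G v)"
    using component_edge[OF assms(1) e(1)] e(2) by auto
  with e(2) have "\<exists>e\<in>medges (component G v). mends G e = {y, z}" by blast
  with step(3) show ?case by (rule rtranclp.rtrancl_into_rtrancl)
qed simp

lemma component_connected:
  assumes "multigraph G" "v \<in> mverts G"
  shows "mg_connected (component G v)"
proof -
  have *: "linked (mends G) (medges (component G v)) v w" if "w \<in> mverts (component G v)" for w
    using linked_in_component[OF assms(1), of v w] that by (simp add: component_simps)
  have "linked (mends G) (medges (component G v)) u w"
    if "u \<in> mverts (component G v)" "w \<in> mverts (component G v)" for u w
    using *[OF that(1)] *[OF that(2)] linked_sym linked_trans by metis
  moreover have "mverts (component G v) \<noteq> {}"
    using in_component_self[OF assms(2)] by blast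
  ultimately show ?thesis
    unfolding mg_connected_iff_linked by (simp add: component_simps(3))
qed

lemma connected_subgraph_of_component:
  assumes "mg_subgraph H G" "mg_connected H" "v \<in> mverts H"
  shows "mg_subgraph H (component G v)"
proof -
  have H: "multigraph H" "mverts H \<subseteq> mverts G" "medges H \<subseteq> medges G" "mends H = mends G"
    using assms(1) by (auto simp: mg_subgraph_def)
  have "linked (mends G) (medges G) v w" if "w \<in> mverts H" for w
    using assms(2,3) that H(3,4) linked_mono[of "mends G" "medges H"]
    unfolding mg_connected_iff_linked by auto
  then show ?thesis
    using H multigraph_edge(2)[OF H(1)] unfolding mg_subgraph_def
    by (fastforce simp: component_simps)
qed

lemma mg_subgraph_antisym: "mg_subgraph A B \<Longrightarrow> mg_subgraph B A \<Longrightarrow> A = B"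
  by (auto simp: mg_subgraph_def intro!: mgraph.equality)

text \<open>A connected subgraph through \<open>v\<close> reaches only vertices linked to
  \<open>v\<close>, so the subgraph induced by these is the largest one.\<close>

lemma mg_components_eq:
  assumes "multigraph G"
  shows "mg_components G = component G ` mverts G"
proof
  show "mg_components G \<subseteq> component G ` mverts G"
  proof
    fix D assume D: "D \<in> mg_components G"
    then have D': "mg_subgraph D G" "mg_connected D" by (auto simp: mg_components_def)
    then obtain v where v: "v \<in> mverts D" "v \<in> mverts G"
      unfolding mg_connected_def mg_subgraph_def by blast
    have "component G v = D"
      using D connected_subgraph_of_component[OF D' v(1)] component_subgraph[OF assms, of v]
        component_connected[OF assms v(2)] unfolding mg_components_def by blast
    then show "D \<in> component G ` mverts G" using v(2) by blast
  qed
  show "component G ` mverts G \<subseteq> mg_components G"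
  proof
    fix D assume "D \<in> component G ` mverts G"
    then obtain v where v: "v \<in> mverts G" "D = component G v" by blast
    have "H' = D" if H': "mg_subgraph H' G" "mg_connected H'" "mg_subgraph D H'" for H'
    proof -
      have "v \<in> mverts H'"
        using H'(3) in_component_self[OF v(1)] v(2) by (auto simp: mg_subgraph_def)
      then show ?thesis
        using connected_subgraph_of_component[OF H'(1,2)] H'(3) v(2) mg_subgraph_antisym by blast
    qed
    then show "D \<in> mg_components G"
      using component_subgraph[OF assms] component_connected[OF assms v(1)] v(2)
      unfolding mg_components_def by blast
  qed
qed

definition spanned :: "('v, 'e) mgraph \<Rightarrow> 'e set \<Rightarrow> ('v, 'e) mgraph" where
  "spanned G X = \<lparr>mverts = \<Union> (mends G ` X), medges = X, mends = mends G\<rparr>"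

lemma spanned_simps [simp]:
  "mverts (spanned G X) = \<Union> (mends G ` X)" "medges (spanned G X) = X"
  "mends (spanned G X) = mends G"
  by (simp_all add: spanned_def)

lemma spanned_subgraph:
  assumes "multigraph G" "X \<subseteq> medges G"
  shows "mg_subgraph (spanned G X) G"
proof -
  have "finite X" using assms by (auto simp: multigraph_def intro: finite_subset)
  then show ?thesis
    using assms multigraph_edge[OF assms(1)] unfolding mg_subgraph_def multigraph_def[of "spanned G X"]
    by (simp add: subset_iff) blast
qed

lemma component_is_cycle:
  assumes "multigraph L" "mg_regular 2 L" "v \<in> mverts L"
  shows "is_cycle (component L v)"
proof -
  have "mg_regular 2 (component L v)"
    using assms(2) edeg_component[OF assms(1)]
    unfolding mg_regular_def mg_degree_eq_edeg by (auto simp: component_simps)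
  then show ?thesis
    using component_subgraph[OF assms(1)] component_connected[OF assms(1,3)]
    by (auto simp: is_cycle_def mg_subgraph_def)
qed

text \<open>The degrees are positive, even and at most 3.\<close>

lemma even_edge_set_regular:
  assumes G: "cubic_graph G" and X: "X \<subseteq> medges G"
    and ev: "\<And>v. v \<in> mverts G \<Longrightarrow> even (edeg (mends G) X v)"
  shows "mg_regular 2 (spanned G X)"
proof -
  have mG: "multigraph G" using G by (simp add: cubic_graph_def)
  then have fin: "finite (medges G)" by (simp add: multigraph_def)
  have "edeg (mends G) X v = 2" if v: "v \<in> \<Union> (mends G ` X)" for v
  proof -
    have vG: "v \<in> mverts G" using v X multigraph_edge(2)[OF mG] by blast
    have "edeg (mends G) X v \<le> edeg (mends G) (medges G) v"
      unfolding edeg_def using X fin by (intro card_mono) auto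
    also have "\<dots> = 3"
      using G vG by (simp add: cubic_graph_def mg_regular_def mg_degree_eq_edeg)
    finally have "edeg (mends G) X v \<le> 3" .
    moreover have "edeg (mends G) X v \<noteq> 0"
      using v edeg_eq_0_iff[of X "mends G" v] finite_subset[OF X fin] by blast
    moreover have "n \<noteq> 0 \<Longrightarrow> even n \<Longrightarrow> n \<le> 3 \<Longrightarrow> n = 2" for n :: nat by presburger
    ultimately show ?thesis using ev[OF vG] by blast
  qed
  then show ?thesis by (simp add: mg_regular_def mg_degree_eq_edeg)
qed

text \<open>The cycles are the components of the even edge sets. No cycle \<open>C\<close> arises
  from two of them: the third edge at a vertex of \<open>C\<close> would have to be covered by
  some other even set, which then contains an edge of \<open>C\<close> at this vertex as well, and
  that edge would be covered three times.\<close>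

lemma even_edge_sets_imp_cdc:
  fixes G :: "('v, 'e) mgraph"
  assumes G: "cubic_graph G"
    and E: "\<And>i. i < n \<Longrightarrow> E i \<subseteq> medges G"
    and ev: "\<And>i v. i < n \<Longrightarrow> v \<in> mverts G \<Longrightarrow> even (edeg (mends G) (E i) v)"
    and two: "\<And>e. e \<in> medges G \<Longrightarrow> card {i. i < n \<and> e \<in> E i} = 2"
  shows "has_k_cdc n G"
proof -
  define L where "L i = spanned G (E i)" for i
  define P where "P i = mg_components (L i)" for i
  have mG: "multigraph G" using G by (simp add: cubic_graph_def)
  then have fin: "finite (medges G)" by (simp add: multigraph_def)
  have subL: "mg_subgraph (L i) G" if "i < n" for i
    unfolding L_def using spanned_subgraph[OF mG E[OF that]] .
  then have mL: "multigraph (L i)" if "i < n" for i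
    using that by (auto simp: mg_subgraph_def)
  have L: "medges (L i) = E i" "mends (L i) = mends G" for i
    by (simp_all add: L_def)
  have P: "P i = component (L i) ` mverts (L i)" if "i < n" for i
    unfolding P_def using mg_components_eq[OF mL[OF that]] .
  have reg: "mg_regular 2 (L i)" if "i < n" for i
    unfolding L_def using even_edge_set_regular[OF G E ev] that by blast
  have subP: "mg_subgraph C G" if "i < n" "C \<in> P i" for i C
    using that subL[of i] unfolding P_def mg_components_def mg_subgraph_def by auto
  have cyc: "is_cycle C" if "i < n" "C \<in> P i" for i C
    using that component_is_cycle[OF mL reg] P by auto
  have PE: "medges C \<subseteq> E i" if "i < n" "C \<in> P i" for i C
    using that by (auto simp: P L component_simps)
  have uniq: "{C \<in> P i. e \<in> medges C} = {component (L i) v}"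
    if "i < n" "e \<in> E i" "v \<in> mends G e" for i e v
  proof -
    have v: "v \<in> mverts (L i)" using that by (auto simp: L_def)
    have "e \<in> medges (component (L i) v)"
      using component_edge[OF mL[OF that(1)], of e v v] that L in_component_self[OF v] by auto
    moreover have "C = component (L i) v" if C: "C \<in> P i" "e \<in> medges C" for C
    proof -
      obtain u where u: "C = component (L i) u" using C(1) P[OF \<open>i < n\<close>] by blast
      then have "v \<in> mverts C"
        using C(2) \<open>v \<in> mends G e\<close> v by (auto simp: component_simps L)
      then show ?thesis using component_eq[of v "L i" u] u by simp
    qed
    ultimately show ?thesis using v P[OF that(1)] by auto
  qed
  have disj_edges: "pairwise (\<lambda>C D. medges C \<inter> medges D = {}) (P i)" if i: "i < n" for i
  proof (rule pairwiseI, rule ccontr)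
    fix C D assume CD: "C \<in> P i" "D \<in> P i" "C \<noteq> D" "medges C \<inter> medges D \<noteq> {}"
    then obtain e where e: "e \<in> medges C" "e \<in> medges D" by blast
    have "e \<in> E i" using PE[OF i CD(1)] e by blast
    then obtain v where "v \<in> mends G e"
      using E[OF i] multigraph_edge(4)[OF mG] by blast
    have "C \<in> {C \<in> P i. e \<in> medges C}" "D \<in> {C \<in> P i. e \<in> medges C}"
      using CD e by auto
    then show False using uniq[OF i \<open>e \<in> E i\<close> \<open>v \<in> mends G e\<close>] CD(3) by simp
  qed
  have disj: "P i \<inter> P j = {}" if ij: "i < n" "j < n" "i \<noteq> j" for i j
  proof (rule ccontr)
    assume "P i \<inter> P j \<noteq> {}"
    then obtain C where C: "C \<in> P i" "C \<in> P j" by blast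
    have "mverts C \<noteq> {}" using cyc[OF ij(1) C(1)] by (auto simp: is_cycle_def mg_connected_def)
    then obtain v where v: "v \<in> mverts C" by blast
    have vG: "v \<in> mverts G" using v subP[OF ij(1) C(1)] by (auto simp: mg_subgraph_def)
    define A where "A = {e \<in> medges C. v \<in> mends G e}"
    define D where "D = {e \<in> medges G. v \<in> mends G e}"
    have "mends C = mends G" using subP[OF ij(1) C(1)] by (simp add: mg_subgraph_def)
    then have "card A = 2"
      using cyc[OF ij(1) C(1)] v by (simp add: is_cycle_def mg_regular_def mg_degree_def A_def)
    moreover have cardD: "card D = 3"
      using G vG by (simp add: cubic_graph_def mg_regular_def mg_degree_def D_def)
    moreover have AD: "A \<subseteq> D"
      using subP[OF ij(1) C(1)] by (auto simp: A_def D_def mg_subgraph_def)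
    moreover have finD: "finite D" using fin by (simp add: D_def)
    ultimately have "card (D - A) = 1"
      by (simp add: card_Diff_subset finite_subset)
    then obtain f where f: "D - A = {f}" by (auto simp: card_1_singleton_iff)
    have fG: "f \<in> medges G" "v \<in> mends G f" using f by (auto simp: D_def)
    have sub: "{e \<in> E l. v \<in> mends G e} \<subseteq> A" if "l = i \<or> l = j" for l
    proof -
      have l: "l < n" "C \<in> P l" using that ij C by auto
      then obtain u where "C = component (L l) u" using P by blast
      then show ?thesis
        using component_edge[OF mL[OF l(1)], of _ v u] v by (auto simp: A_def L)
    qed
    \<comment> \<open>\<open>f\<close> is the edge at \<open>v\<close> outside \<open>C\<close>;
      an even set containing it has a second edge at \<open>v\<close>.\<close>
    have "f \<notin> E i" "f \<notin> E j" using sub[of i] sub[of j] f fG by blast+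
    have "{l. l < n \<and> f \<in> E l} \<noteq> {}" using two[OF fG(1)] by (metis card.empty zero_neq_numeral)
    then obtain l where l: "l < n" "f \<in> E l" by blast
    then have "l \<noteq> i" "l \<noteq> j" using \<open>f \<notin> E i\<close> \<open>f \<notin> E j\<close> by auto
    have "{e \<in> E l. v \<in> mends G e} \<noteq> {f}"
    proof
      assume "{e \<in> E l. v \<in> mends G e} = {f}"
      then have "edeg (mends G) (E l) v = 1" by (simp add: edeg_def)
      then show False using ev[OF l(1) vG] by simp
    qed
    then obtain e where e: "e \<in> E l" "v \<in> mends G e" "e \<noteq> f" using l(2) fG(2) by blast
    have "e \<in> medges G" using e(1) E[OF l(1)] by blast
    then have "e \<in> A" using e f by (auto simp: D_def)
    then have "e \<in> E i" "e \<in> E j" using PE C ij by (auto simp: A_def)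
    then have "{i, j, l} \<subseteq> {k. k < n \<and> e \<in> E k}" using ij l(1) e(1) by auto
    then have "card {i, j, l} \<le> card {k. k < n \<and> e \<in> E k}" by (intro card_mono) auto
    then show False
      using two[OF \<open>e \<in> medges G\<close>] \<open>i \<noteq> j\<close> \<open>l \<noteq> i\<close> \<open>l \<noteq> j\<close> by simp
  qed
  have "card {C \<in> (\<Union>i<n. P i). e \<in> medges C} = 2" if e: "e \<in> medges G" for e
  proof -
    define I where "I = {i. i < n \<and> e \<in> E i}"
    obtain v where v: "v \<in> mends G e" using multigraph_edge(4)[OF mG e] by blast
    have "{C \<in> (\<Union>i<n. P i). e \<in> medges C} = (\<Union>i\<in>I. {C \<in> P i. e \<in> medges C})"
      using PE by (auto simp: I_def)
    also have "card \<dots> = (\<Sum>i\<in>I. card {C \<in> P i. e \<in> medges C})"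
    proof (rule card_UN_disjoint)
      show "finite I" by (simp add: I_def)
      show "\<forall>i\<in>I. finite {C \<in> P i. e \<in> medges C}" using uniq v by (auto simp: I_def)
      show "\<forall>i\<in>I. \<forall>j\<in>I. i \<noteq> j \<longrightarrow>
          {C \<in> P i. e \<in> medges C} \<inter> {C \<in> P j. e \<in> medges C} = {}"
        using disj by (fastforce simp: I_def)
    qed
    also have "\<dots> = (\<Sum>i\<in>I. 1)"
      using uniq v by (intro sum.cong) (auto simp: I_def)
    also have "\<dots> = 2" using two[OF e] by (simp add: I_def)
    finally show ?thesis .
  qed
  then have "cycle_double_cover G (\<Union>i<n. P i)"
    using cyc subP unfolding cycle_double_cover_def by blast
  moreover have "disjoint_family_on P {..<n}"
    using disj by (auto simp: disjoint_family_on_def)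
  ultimately show ?thesis
    using disj_edges unfolding has_k_cdc_def by blast
qed

section \<open>From coloured classes to six even edge sets\<close>

text \<open>On a connected class of \<open>R k\<close> the set \<open>Z k\<close> is a T-join for
  the ends of \<open>M k\<close>. Hence \<open>Z k\<close> and its complement in the even set
  \<open>R k\<close> have the same parities as \<open>M k\<close>, and both become even by adding
  \<open>M k\<close>. An edge of \<open>A\<close> misses just the two sets belonging to its own
  colour and is covered once for each of the other two colours; an edge outside \<open>A\<close>
  is covered by both sets of its class.\<close>

lemma colour_classes_imp_6_cdc:
  fixes G :: "('v, 'e) mgraph" and c \<mu> :: "'e \<Rightarrow> nat" and A :: "'e set"
  defines "R k \<equiv> {e \<in> A. c e \<noteq> k}" and "M k \<equiv> {e \<in> medges G - A. \<mu> e = k}"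
  assumes G: "cubic_graph G" and A: "A \<subseteq> medges G"
    and c: "\<And>e. e \<in> A \<Longrightarrow> c e < 3" and \<mu>: "\<And>e. e \<in> medges G - A \<Longrightarrow> \<mu> e < 3"
    and ev: "\<And>k v. k < 3 \<Longrightarrow> v \<in> mverts G \<Longrightarrow> even (edeg (mends G) (R k) v)"
    and par: "\<And>k v. k < 3 \<Longrightarrow> v \<in> mverts G \<Longrightarrow>
      even (\<Sum>w\<in>{w \<in> mverts G. linked (mends G) (R k) v w}. edeg (mends G) (M k) w)"
  shows "has_k_cdc 6 G"
proof -
  have mG: "multigraph G" using G by (simp add: cubic_graph_def)
  then have fin: "finite (medges G)" "finite (mverts G)" by (simp_all add: multigraph_def)
  have subs: "R k \<subseteq> A" "R k \<subseteq> medges G" "M k \<subseteq> medges G" "R k \<inter> M k = {}" for k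
    using A by (auto simp: R_def M_def)
  have finRM: "finite (R k)" "finite (M k)" for k
    using subs fin finite_subset by metis+
  have "\<exists>Z\<subseteq>R k. \<forall>v\<in>mverts G. even (edeg (mends G) Z v + edeg (mends G) (M k) v)"
    if "k < 3" for k
  proof (rule T_join_exists[OF finRM(1) _ _ fin(2)])
    fix e assume "e \<in> R k"
    then have "e \<in> medges G" using subs(2) by blast
    then show "card (mends G e) = 2" "mends G e \<subseteq> mverts G"
      using multigraph_edge[OF mG] by blast+
  qed (rule par[OF that])
  then obtain Z where Z: "\<And>k. k < 3 \<Longrightarrow> Z k \<subseteq> R k"
    "\<And>k v. k < 3 \<Longrightarrow> v \<in> mverts G \<Longrightarrow> even (edeg (mends G) (Z k) v + edeg (mends G) (M k) v)"
    by metis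
  \<comment> \<open>The sets with index \<open>2 * k\<close> and \<open>2 * k + 1\<close> belong
    to colour \<open>k\<close>.\<close>
  define E where
    "E i = (if even i then Z (i div 2) else R (i div 2) - Z (i div 2)) \<union> M (i div 2)" for i
  have half: "i div 2 < 3" if "i < 6" for i :: nat using that by simp
  show ?thesis
  proof (rule even_edge_sets_imp_cdc[OF G, of 6 E])
    fix i :: nat assume i: "i < 6"
    show "E i \<subseteq> medges G"
      using Z(1)[OF half[OF i]] subs[of "i div 2"] by (auto simp: E_def)
    fix v assume v: "v \<in> mverts G"
    have "edeg (mends G) (Z (i div 2)) v + edeg (mends G) (R (i div 2) - Z (i div 2)) v
        = edeg (mends G) (R (i div 2)) v"
      using edeg_Diff finRM Z(1)[OF half[OF i]] by metis
    moreover have "edeg (mends G) (E i) v =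
        edeg (mends G) (if even i then Z (i div 2) else R (i div 2) - Z (i div 2)) v
          + edeg (mends G) (M (i div 2)) v"
      unfolding E_def using Z(1)[OF half[OF i]] subs(4)[of "i div 2"] finRM[of "i div 2"]
      by (intro edeg_Un_disjoint) (auto intro: finite_subset)
    moreover have "even (edeg (mends G) (R (i div 2)) v)" using ev[OF half[OF i] v] .
    moreover have "even (edeg (mends G) (Z (i div 2)) v + edeg (mends G) (M (i div 2)) v)"
      using Z(2)[OF half[OF i] v] .
    ultimately show "even (edeg (mends G) (E i) v)"
      by (cases "even i") (simp_all, metis even_add)
  next
    fix e assume e: "e \<in> medges G"
    show "card {i. i < 6 \<and> e \<in> E i} = 2"
    proof (cases "e \<in> A")
      case True
      define h where "h k = (if e \<in> Z k then 2 * k else Suc (2 * k))" for k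
      have in_E: "e \<in> E i \<longleftrightarrow> i div 2 \<noteq> c e \<and> i = h (i div 2)" if "i < 6" for i
      proof -
        have Zc: "e \<in> Z (i div 2) \<Longrightarrow> c e \<noteq> i div 2"
          using Z(1)[OF half[OF that]] by (auto simp: R_def)
        show ?thesis
        proof (cases "even i")
          case even: True
          then obtain k where "i = 2 * k" by (elim evenE)
          then show ?thesis using True Zc by (auto simp: E_def R_def M_def h_def)
        next
          case odd: False
          then obtain k where "i = 2 * k + 1" by (elim oddE)
          then show ?thesis using True Zc by (auto simp: E_def R_def M_def h_def)
        qed
      qed
      have h2: "h k div 2 = k" "k < 3 \<Longrightarrow> h k < 6" for k by (auto simp: h_def)
      have "{i. i < 6 \<and> e \<in> E i} = h ` ({..<3} - {c e})"
      proof (intro set_eqI iffI)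
        fix i assume "i \<in> {i. i < 6 \<and> e \<in> E i}"
        then show "i \<in> h ` ({..<3} - {c e})"
          using in_E[of i] half[of i] by (intro image_eqI[of _ _ "i div 2"]) auto
      next
        fix i assume "i \<in> h ` ({..<3} - {c e})"
        then obtain k where "i = h k" "k < 3" "k \<noteq> c e" by auto
        then show "i \<in> {i. i < 6 \<and> e \<in> E i}" using in_E[of i] h2[of k] by simp
      qed
      moreover have "inj h" using h2(1) by (metis injI)
      ultimately show ?thesis
        using c[OF True] by (simp add: card_image inj_on_subset)
    next
      case False
      then have m: "\<mu> e < 3" "e \<in> medges G - A" using \<mu> e by auto
      have "e \<in> E i \<longleftrightarrow> i div 2 = \<mu> e" if "i < 6" for i
        using Z(1)[OF half[OF that]] False m by (auto simp: E_def R_def M_def)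
      then have "{i. i < 6 \<and> e \<in> E i} = {2 * \<mu> e, Suc (2 * \<mu> e)}"
        using m(1) by auto
      then show ?thesis by simp
    qed
  qed
qed

section \<open>Colourings of the components\<close>

text \<open>The properties shared by monochromatic cycles and by subdivisions of a Kotzig graph
  with the inherited colouring. Dropping a colour must leave a graph that is connected up to
  isolated vertices; by the condition at the vertices it is then empty or a single cycle.\<close>

definition good_colouring :: "('v, 'e) mgraph \<Rightarrow> ('e \<Rightarrow> nat) \<Rightarrow> bool" where
  "good_colouring H c \<longleftrightarrow> c ` medges H \<subseteq> {..<3} \<and>
    (\<forall>v\<in>mverts H.
       mg_degree H v = 2 \<and> (\<exists>i. \<forall>e\<in>medges H. v \<in> mends H e \<longrightarrow> c e = i) \<or>
       mg_degree H v = 3 \<and> inj_on c {e \<in> medges H. v \<in> mends H e}) \<and>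
    (\<forall>k<3. \<forall>e\<in>medges H. \<forall>f\<in>medges H. c e \<noteq> k \<longrightarrow> c f \<noteq> k \<longrightarrow>
       (\<forall>u\<in>mends H e. \<forall>v\<in>mends H f. linked (mends H) {g \<in> medges H. c g \<noteq> k} u v))"

lemma good_colouring_at:
  assumes "good_colouring H c" "v \<in> mverts H"
  shows "mg_degree H v = 2 \<and> (\<exists>i. \<forall>e\<in>medges H. v \<in> mends H e \<longrightarrow> c e = i) \<or>
       mg_degree H v = 3 \<and> inj_on c {e \<in> medges H. v \<in> mends H e}"
  using assms(1)[unfolded good_colouring_def, THEN conjunct2, THEN conjunct1] assms(2) by (rule bspec)

lemma good_colouring_connected:
  assumes "good_colouring H c" "k < 3"
    and "e \<in> medges H" "c e \<noteq> k" "u \<in> mends H e" and "f \<in> medges H" "c f \<noteq> k" "v \<in> mends H f"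
  shows "linked (mends H) {g \<in> medges H. c g \<noteq> k} u v"
  using assms(1)[unfolded good_colouring_def, THEN conjunct2, THEN conjunct2] assms(2-) by simp

lemma good_colouring_permute:
  assumes c: "good_colouring H c" and p: "inj p" "p ` {..<3} = {..<3}"
  shows "good_colouring H (p \<circ> c)"
  unfolding good_colouring_def
proof (intro conjI ballI allI impI)
  show "(p \<circ> c) ` medges H \<subseteq> {..<3}"
    using c p(2) unfolding good_colouring_def image_comp[symmetric] by blast
next
  fix v assume "v \<in> mverts H"
  then consider "mg_degree H v = 2" "\<exists>i. \<forall>e\<in>medges H. v \<in> mends H e \<longrightarrow> c e = i"
    | "mg_degree H v = 3" "inj_on c {e \<in> medges H. v \<in> mends H e}"
    using good_colouring_at[OF c] by blast
  then show "mg_degree H v = 2 \<and> (\<exists>i. \<forall>e\<in>medges H. v \<in> mends H e \<longrightarrow> (p \<circ> c) e = i) \<or>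
       mg_degree H v = 3 \<and> inj_on (p \<circ> c) {e \<in> medges H. v \<in> mends H e}"
  proof cases
    case 1 then show ?thesis by auto
  next
    case 2 then show ?thesis using p(1) by (auto intro: comp_inj_on inj_on_subset)
  qed
next
  fix k :: nat and e f u v
  assume *: "k < 3" "e \<in> medges H" "f \<in> medges H" "(p \<circ> c) e \<noteq> k" "(p \<circ> c) f \<noteq> k"
    "u \<in> mends H e" "v \<in> mends H f"
  obtain j where j: "j < 3" "k = p j" using p(2) *(1) by (metis imageE lessThan_iff)
  have "p (c g) \<noteq> k \<longleftrightarrow> c g \<noteq> j" for g using p(1) j(2) by (auto dest: injD)
  then show "linked (mends H) {g \<in> medges H. (p \<circ> c) g \<noteq> k} u v"
    using good_colouring_connected[OF c j(1)] * by simp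
qed

lemma good_colouring_cycle:
  assumes "is_cycle H" "i < 3"
  shows "good_colouring H (\<lambda>_. i)"
proof -
  have H: "multigraph H" using assms by (simp add: is_cycle_def)
  have "linked (mends H) {g \<in> medges H. i \<noteq> k} u v"
    if "e \<in> medges H" "f \<in> medges H" "i \<noteq> k" "u \<in> mends H e" "v \<in> mends H f" for k e f u v
  proof -
    have "u \<in> mverts H" "v \<in> mverts H" using that multigraph_edge(2)[OF H] by blast+
    then show ?thesis
      using assms(1) that(3) by (simp add: is_cycle_def mg_connected_iff_linked)
  qed
  then show ?thesis
    using assms unfolding good_colouring_def is_cycle_def mg_regular_def by auto
qed

lemma card_two_of_three_colours:
  fixes c :: "'e \<Rightarrow> nat"
  assumes inj: "inj_on c D" and D: "finite D" "card D = 3" "c ` D \<subseteq> {..<3}" and k: "k < 3"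
  shows "card {e \<in> D. c e \<noteq> k} = 2"
proof -
  have "card (c ` D) = 3" using card_image[OF inj] D by simp
  then have cD: "c ` D = {..<3}" using D(3) by (intro card_subset_eq) auto
  have "card {e \<in> D. c e \<noteq> k} = card (c ` {e \<in> D. c e \<noteq> k})"
    using inj by (intro card_image[symmetric]) (auto intro: inj_on_subset)
  also have "c ` {e \<in> D. c e \<noteq> k} = {..<3} - {k}" using cD by blast
  also have "card \<dots> = 2" using k by simp
  finally show ?thesis .
qed

lemma good_colouring_even:
  assumes c: "good_colouring H c" and H: "multigraph H" and v: "v \<in> mverts H" and k: "k < 3"
  shows "even (edeg (mends H) {e \<in> medges H. c e \<noteq> k} v)"
proof -
  define D where "D = {e \<in> medges H. v \<in> mends H e}"
  have eq: "edeg (mends H) {e \<in> medges H. c e \<noteq> k} v = card {e \<in> D. c e \<noteq> k}"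
    by (simp add: edeg_def D_def conj_commute conj_left_commute)
  have D: "c ` D \<subseteq> {..<3}" "finite D"
    using c H by (auto simp: good_colouring_def D_def multigraph_def)
  have "card D = 2 \<and> (\<exists>i. \<forall>e\<in>D. c e = i) \<or> card D = 3 \<and> inj_on c D"
    using good_colouring_at[OF c v] by (auto simp: mg_degree_def D_def)
  then consider i where "card D = 2" "\<forall>e\<in>D. c e = i" | "card D = 3" "inj_on c D" by blast
  then show ?thesis
  proof cases
    case 1
    then have "{e \<in> D. c e \<noteq> k} = (if i = k then {} else D)" by auto
    then show ?thesis using 1(1) by (simp add: eq)
  next
    case 2
    then have "card {e \<in> D. c e \<noteq> k} = 2"
      using card_two_of_three_colours[OF 2(2) D(2) 2(1) D(1) k] by blast
    then show ?thesis by (simp add: eq)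
  qed
qed

lemma proper_colouring_inj_at:
  assumes "proper_3_edge_coloring K c"
  shows "inj_on c {e \<in> medges K. w \<in> mends K e}"
proof (rule inj_onI, rule ccontr)
  fix e f
  assume "e \<in> {e \<in> medges K. w \<in> mends K e}" "f \<in> {e \<in> medges K. w \<in> mends K e}"
    "c e = c f" "e \<noteq> f"
  then show False using assms by (auto simp: proper_3_edge_coloring_def)
qed

text \<open>The edges of two colours form a 2-regular spanning graph; each of its components is a
  cycle with two colours, hence hamiltonian.\<close>

lemma kotzig_two_colours_connected:
  assumes K: "cubic_graph K" and c: "proper_3_edge_coloring K c"
    and ham: "\<And>C. is_cycle C \<Longrightarrow> mg_subgraph C K \<Longrightarrow> card (c ` medges C) \<le> 2 \<Longrightarrow> mverts C = mverts K"
    and k: "k < 3" and uv: "u \<in> mverts K" "v \<in> mverts K"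
  shows "linked (mends K) {e \<in> medges K. c e \<noteq> k} u v"
proof -
  define X where "X = {e \<in> medges K. c e \<noteq> k}"
  define L where "L = \<lparr>mverts = mverts K, medges = X, mends = mends K\<rparr>"
  have mK: "multigraph K" using K by (simp add: cubic_graph_def)
  then have fin: "finite (medges K)" by (simp add: multigraph_def)
  have L: "mverts L = mverts K" "medges L = X" "mends L = mends K" by (simp_all add: L_def)
  have mL: "multigraph L" using mK by (auto simp: multigraph_def L X_def)
  have "mg_degree L w = 2" if w: "w \<in> mverts K" for w
  proof -
    define D where "D = {e \<in> medges K. w \<in> mends K e}"
    have D: "finite D" "card D = 3"
      using K w fin by (simp_all add: D_def cubic_graph_def mg_regular_def mg_degree_def)
    have inj: "inj_on c D" unfolding D_def by (rule proper_colouring_inj_at[OF c])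
    have "c ` D \<subseteq> {..<3}" using c by (auto simp: proper_3_edge_coloring_def D_def)
    then have "card {e \<in> D. c e \<noteq> k} = 2"
      using card_two_of_three_colours[OF inj D] k by blast
    then show ?thesis
      by (simp add: mg_degree_def L X_def D_def conj_commute conj_left_commute)
  qed
  then have reg: "mg_regular 2 L" by (simp add: mg_regular_def L)
  have "u \<in> mverts L" using uv by (simp add: L)
  then have cyc: "is_cycle (component L u)" by (rule component_is_cycle[OF mL reg])
  have "mg_subgraph (component L u) K"
    using component_subgraph[OF mL, of u] by (auto simp: mg_subgraph_def L X_def)
  moreover have "card (c ` medges (component L u)) \<le> 2"
  proof -
    have "c ` medges (component L u) \<subseteq> {..<3} - {k}"
      using c by (auto simp: component_simps L X_def proper_3_edge_coloring_def)
    then have "card (c ` medges (component L u)) \<le> card ({..<3} - {k})"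
      by (intro card_mono) auto
    then show ?thesis using k by simp
  qed
  ultimately have "mverts (component L u) = mverts K" using ham[OF cyc] by blast
  then show ?thesis using uv(2) by (auto simp: component_simps L X_def)
qed

section \<open>Subdivided Kotzig graphs\<close>

lemma inner_verts_nth: "inner_verts vs = {vs ! j | j. 0 < j \<and> Suc j < length vs}"
proof -
  have "inner_verts vs = {butlast (tl vs) ! i | i. i < length vs - 2}"
    by (simp add: inner_verts_def set_conv_nth numeral_2_eq_2)
  also have "\<dots> = {vs ! Suc i | i. i < length vs - 2}"
    by (rule Collect_cong, rule ex_cong1) (auto simp: nth_butlast nth_tl)
  also have "\<dots> = {vs ! j | j. 0 < j \<and> Suc j < length vs}"
  proof (rule Collect_cong, standard)
    fix x assume "\<exists>i. x = vs ! Suc i \<and> i < length vs - 2"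
    then obtain i where "x = vs ! Suc i" "i < length vs - 2" by blast
    then show "\<exists>j. x = vs ! j \<and> 0 < j \<and> Suc j < length vs"
      by (intro exI[of _ "Suc i"]) auto
  next
    fix x assume "\<exists>j. x = vs ! j \<and> 0 < j \<and> Suc j < length vs"
    then obtain j where "x = vs ! j" "0 < j" "Suc j < length vs" by blast
    then show "\<exists>i. x = vs ! Suc i \<and> i < length vs - 2"
      by (intro exI[of _ "j - 1"]) auto
  qed
  finally show ?thesis .
qed

lemma path_edges_at:
  assumes p: "is_path H vs es" and j: "j < length vs"
  shows "{f \<in> set es. vs ! j \<in> mends H f} = {es ! i | i. i < length es \<and> (i = j \<or> Suc i = j)}"
proof -
  have vs: "distinct vs" "length vs = Suc (length es)"
    and ends: "\<And>i. i < length es \<Longrightarrow> mends H (es ! i) = {vs ! i, vs ! Suc i}"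
    using p by (auto simp: is_path_def)
  have "vs ! j \<in> mends H (es ! i) \<longleftrightarrow> i = j \<or> Suc i = j" if "i < length es" for i
    using ends[OF that] that j vs by (auto simp: nth_eq_iff_index_eq)
  then show ?thesis by (auto simp: in_set_conv_nth)
qed

lemma path_ends_subset:
  assumes "is_path H vs es" "f \<in> set es" shows "mends H f \<subseteq> set vs"
  using assms unfolding is_path_def in_set_conv_nth[of f] by fastforce

lemma path_verts_cases:
  assumes "is_path H vs es" "u \<in> set vs"
  shows "u = hd vs \<or> u = last vs \<or> u \<in> inner_verts vs"
proof -
  have ne: "vs \<noteq> []" using assms(2) by auto
  obtain j where j: "j < length vs" "u = vs ! j" using assms(2) by (auto simp: in_set_conv_nth)
  then consider "j = 0" | "Suc j = length vs" | "0 < j" "Suc j < length vs" by linarith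
  then show ?thesis
  proof cases
    case 1 then show ?thesis using j ne by (simp add: hd_conv_nth)
  next
    case 2 then show ?thesis using j ne by (metis diff_Suc_1 last_conv_nth)
  next
    case 3 then show ?thesis using j by (auto simp: inner_verts_nth)
  qed
qed

lemma path_edges_distinct:
  assumes p: "is_path H vs es" and ij: "i < length es" "j < length es" "es ! i = es ! j"
  shows "i = j"
proof -
  have vs: "distinct vs" "length vs = Suc (length es)"
    and ends: "\<And>i. i < length es \<Longrightarrow> mends H (es ! i) = {vs ! i, vs ! Suc i}"
    using p by (auto simp: is_path_def)
  have "{vs ! i, vs ! Suc i} = {vs ! j, vs ! Suc j}" using ends ij by metis
  then show ?thesis using vs ij(1,2) by (auto simp: doubleton_eq_iff nth_eq_iff_index_eq)
qed

lemma path_inner_degree: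
  assumes p: "is_path H vs es" and u: "u \<in> inner_verts vs"
  shows "card {f \<in> set es. u \<in> mends H f} = 2"
proof -
  obtain j where j: "u = vs ! j" "0 < j" "Suc j < length vs" using u by (auto simp: inner_verts_nth)
  have len: "length vs = Suc (length es)" using p by (simp add: is_path_def)
  have "{f \<in> set es. u \<in> mends H f} = {es ! i | i. i < length es \<and> (i = j \<or> Suc i = j)}"
    using path_edges_at[OF p] j by simp
  also have "\<dots> = {es ! (j - 1), es ! j}"
    using j len by (auto intro: exI[of _ "j - 1"])
  finally have "{f \<in> set es. u \<in> mends H f} = {es ! (j - 1), es ! j}" .
  moreover have "es ! (j - 1) \<noteq> es ! j"
    using path_edges_distinct[OF p, of "j - 1" j] j len by fastforce
  ultimately show ?thesis by simp
qed

lemma path_end_edge: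
  assumes p: "is_path H vs es" and ne: "hd vs \<noteq> last vs" and u: "u \<in> {hd vs, last vs}"
  shows "\<exists>g. {f \<in> set es. u \<in> mends H f} = {g}"
proof -
  have len: "length vs = Suc (length es)" using p by (simp add: is_path_def)
  then have vs: "vs \<noteq> []" by auto
  have pos: "0 < length es"
    using ne len by (cases vs) auto
  define n where "n = length es"
  consider "u = vs ! 0" | "u = vs ! n"
    using u vs len by (auto simp: hd_conv_nth last_conv_nth n_def)
  then show ?thesis
  proof cases
    case 1
    then have "{f \<in> set es. u \<in> mends H f} = {es ! 0}"
      using path_edges_at[OF p, of 0] pos len by auto
    then show ?thesis by blast
  next
    case 2
    then have "{f \<in> set es. u \<in> mends H f} = {es ! i | i. i < n \<and> (i = n \<or> Suc i = n)}"
      using path_edges_at[OF p, of n] len by (simp add: n_def)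
    also have "\<dots> = {es ! (n - 1)}" using pos by (auto simp: n_def intro!: arg_cong[of _ _ "(!) es"])
    finally show ?thesis by blast
  qed
qed

lemma path_linked:
  assumes p: "is_path H vs es" and "u \<in> set vs" "v \<in> set vs"
  shows "linked (mends H) (set es) u v"
proof -
  have len: "length vs = Suc (length es)"
    and ends: "\<And>i. i < length es \<Longrightarrow> mends H (es ! i) = {vs ! i, vs ! Suc i}"
    using p by (auto simp: is_path_def)
  have *: "linked (mends H) (set es) (vs ! 0) (vs ! j)" if "j < length vs" for j
    using that
  proof (induction j)
    case (Suc j)
    then have "linked (mends H) (set es) (vs ! j) (vs ! Suc j)"
      using ends[of j] len by (intro linked_edge[of "es ! j"]) auto
    with Suc show ?case using linked_trans by (metis Suc_lessD)
  qed simp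
  have "linked (mends H) (set es) (vs ! 0) u" "linked (mends H) (set es) (vs ! 0) v"
    using * assms(2,3) by (auto simp: in_set_conv_nth)
  then show ?thesis using linked_sym linked_trans by metis
qed

text \<open>Each edge of a subdivision gets the colour of the edge of the Kotzig graph on whose
  path it lies. Inner vertices of the paths then see one colour, branch vertices all three, and
  connections that avoid a colour lift from the Kotzig graph to its subdivision. Branch vertices
  have degree 3, so a subdivided Kotzig graph is not a cycle.\<close>

lemma subdivided_kotzig_colouring:
  fixes H :: "('v, 'e) mgraph"
  assumes "subdivided_kotzig H"
  shows "\<exists>c. good_colouring H c" and "\<exists>v\<in>mverts H. mg_degree H v = 3"
proof -
  obtain K :: "(nat, nat) mgraph" where K: "kotzig_graph K" and sub: "subdivision_of H K"
    using assms by (auto simp: subdivided_kotzig_def)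
  obtain c where c: "proper_3_edge_coloring K c"
    and ham: "\<And>C. is_cycle C \<Longrightarrow> mg_subgraph C K \<Longrightarrow> card (c ` medges C) \<le> 2 \<Longrightarrow> mverts C = mverts K"
    using K by (auto simp: kotzig_graph_def)
  have cubK: "cubic_graph K" using K by (simp add: kotzig_graph_def)
  then have mK: "multigraph K" by (simp add: cubic_graph_def)
  obtain \<phi> pv pe where inj: "inj_on \<phi> (mverts K)"
    and paths: "\<forall>e\<in>medges K. is_path H (pv e) (pe e) \<and>
        {hd (pv e), last (pv e)} = \<phi> ` mends K e \<and>
        inner_verts (pv e) \<inter> \<phi> ` mverts K = {}"
    and paths_disj: "\<forall>e\<in>medges K. \<forall>f\<in>medges K. e \<noteq> f \<longrightarrow>
        inner_verts (pv e) \<inter> inner_verts (pv f) = {} \<and> set (pe e) \<inter> set (pe f) = {}"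
    and verts: "mverts H = \<phi> ` mverts K \<union> (\<Union>e\<in>medges K. inner_verts (pv e))"
    and edges: "medges H = (\<Union>e\<in>medges K. set (pe e))"
    and long: "\<exists>e\<in>medges K. 2 \<le> length (pe e)"
    using sub unfolding subdivision_of_def by (elim conjE exE) (rule that)
  have path: "is_path H (pv e) (pe e)"
    and ends: "{hd (pv e), last (pv e)} = \<phi> ` mends K e"
    and inner: "inner_verts (pv e) \<inter> \<phi> ` mverts K = {}" if "e \<in> medges K" for e
    using paths that by blast+
  have disj: "inner_verts (pv e) \<inter> inner_verts (pv f) = {} \<and> set (pe e) \<inter> set (pe f) = {}"
    if "e \<in> medges K" "f \<in> medges K" "e \<noteq> f" for e f
    using paths_disj that by blast
  have hd_last: "hd (pv e) \<noteq> last (pv e)" if "e \<in> medges K" for e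
  proof
    assume "hd (pv e) = last (pv e)"
    then have "card (\<phi> ` mends K e) = 1" using ends[OF that, symmetric] by simp
    moreover have "card (\<phi> ` mends K e) = 2"
      using card_image[OF inj_on_subset[OF inj multigraph_edge(2)[OF mK that]]]
        multigraph_edge(1)[OF mK that] by simp
    ultimately show False by simp
  qed
  have branch_in: "\<phi> v \<in> set (pv e)" if "e \<in> medges K" "v \<in> mends K e" for e v
  proof -
    have "pv e \<noteq> []" using path[OF that(1)] by (auto simp: is_path_def)
    moreover have "\<phi> v \<in> {hd (pv e), last (pv e)}" using ends that by blast
    ultimately show ?thesis by auto
  qed
  have branch_out: "v \<in> mends K e"
    if e: "e \<in> medges K" and v: "v \<in> mverts K" and in_e: "\<phi> v \<in> set (pv e)" for e v
  proof -
    have "\<phi> v \<notin> inner_verts (pv e)" using inner[OF e] v by blast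
    then have "\<phi> v \<in> \<phi> ` mends K e"
      using path_verts_cases[OF path[OF e] in_e] ends[OF e] by blast
    then show ?thesis using inj v multigraph_edge(2)[OF mK e] by (auto dest: inj_onD)
  qed
  define cH where "cH f = c (THE e. e \<in> medges K \<and> f \<in> set (pe e))" for f
  have cH: "cH f = c e" if "e \<in> medges K" "f \<in> set (pe e)" for e f
  proof -
    have "(THE e. e \<in> medges K \<and> f \<in> set (pe e)) = e"
      using that disj by (intro the_equality) blast+
    then show ?thesis by (simp add: cH_def)
  qed
  have at_branch: "card {f \<in> medges H. \<phi> v \<in> mends H f} = 3"
    "inj_on cH {f \<in> medges H. \<phi> v \<in> mends H f}" if v: "v \<in> mverts K" for v
  proof -
    define D where "D = {e \<in> medges K. v \<in> mends K e}"
    have "\<exists>g. {f \<in> set (pe e). \<phi> v \<in> mends H f} = {g}" if "e \<in> D" for e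
      using path_end_edge[OF path hd_last, of e "\<phi> v"] ends[of e] that by (auto simp: D_def)
    then obtain g where g: "\<And>e. e \<in> D \<Longrightarrow> {f \<in> set (pe e). \<phi> v \<in> mends H f} = {g e}"
      by metis
    have "{f \<in> medges H. \<phi> v \<in> mends H f} = (\<Union>e\<in>D. {f \<in> set (pe e). \<phi> v \<in> mends H f})"
      using branch_out[OF _ v] path_ends_subset[OF path] unfolding edges D_def by blast
    also have "\<dots> = (\<Union>e\<in>D. {g e})" using g by (intro SUP_cong) auto
    also have "\<dots> = g ` D" by blast
    finally have eq: "{f \<in> medges H. \<phi> v \<in> mends H f} = g ` D" .
    have "(cH \<circ> g) e = c e" if "e \<in> D" for e
      using g[OF that] that cH[of e "g e"] by (auto simp: D_def)
    moreover have "inj_on c D" unfolding D_def by (rule proper_colouring_inj_at[OF c])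
    ultimately have inj_cg: "inj_on (cH \<circ> g) D" using inj_on_cong[of D "cH \<circ> g" c] by blast
    then show "inj_on cH {f \<in> medges H. \<phi> v \<in> mends H f}"
      unfolding eq by (rule inj_on_imageI)
    have "inj_on g D" using inj_cg by (rule inj_on_imageI2)
    then have "card (g ` D) = card D" by (rule card_image)
    also have "\<dots> = 3"
      using cubK v by (simp add: cubic_graph_def mg_regular_def mg_degree_def D_def)
    finally show "card {f \<in> medges H. \<phi> v \<in> mends H f} = 3" unfolding eq .
  qed
  have at_inner: "{f \<in> medges H. u \<in> mends H f} = {f \<in> set (pe e). u \<in> mends H f}"
    if e: "e \<in> medges K" and u: "u \<in> inner_verts (pv e)" for e u
  proof -
    have "e' = e" if e': "e' \<in> medges K" "f \<in> set (pe e')" "u \<in> mends H f" for e' f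
    proof -
      have "u \<notin> \<phi> ` mverts K" using inner[OF e] u by blast
      then have "u \<notin> {hd (pv e'), last (pv e')}"
        using ends[OF e'(1)] multigraph_edge(2)[OF mK e'(1)] by blast
      moreover have "u \<in> set (pv e')" using path_ends_subset[OF path] e' by blast
      ultimately have "u \<in> inner_verts (pv e')"
        using path_verts_cases[OF path[OF e'(1)]] by blast
      then show ?thesis using disj e e'(1) u by blast
    qed
    then show ?thesis using e by (auto simp: edges)
  qed
  have branch_linked: "linked (mends H) {g \<in> medges H. cH g \<noteq> k} (\<phi> a) (\<phi> b)"
    if "linked (mends K) {e \<in> medges K. c e \<noteq> k} a b" for a b k
    using that unfolding linked_def[of "mends K"]
  proof (induction rule: rtranclp_induct)
    case (step y z)
    then obtain e where e: "e \<in> medges K" "c e \<noteq> k" "mends K e = {y, z}" by blast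
    have "linked (mends H) (set (pe e)) (\<phi> y) (\<phi> z)"
      using branch_in[OF e(1)] e(3) by (intro path_linked[OF path[OF e(1)]]) auto
    moreover have "set (pe e) \<subseteq> {g \<in> medges H. cH g \<noteq> k}"
      using e(1,2) cH[OF e(1)] by (auto simp: edges)
    ultimately show ?case using step(3) linked_mono linked_trans by metis
  qed simp
  have to_branch: "\<exists>a\<in>mverts K. linked (mends H) {g \<in> medges H. cH g \<noteq> k} u (\<phi> a)"
    if f: "f \<in> medges H" "cH f \<noteq> k" "u \<in> mends H f" for f u k
  proof -
    obtain e where e: "e \<in> medges K" "f \<in> set (pe e)" using f(1) by (auto simp: edges)
    obtain a where a: "a \<in> mends K e" using multigraph_edge(4)[OF mK e(1)] by blast
    have "u \<in> set (pv e)" using path_ends_subset[OF path[OF e(1)] e(2)] f(3) by blast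
    then have "linked (mends H) (set (pe e)) u (\<phi> a)"
      using path_linked[OF path[OF e(1)]] branch_in[OF e(1) a] by blast
    moreover have "set (pe e) \<subseteq> {g \<in> medges H. cH g \<noteq> k}"
      using e(1) f(2) cH[OF e(1)] cH[OF e] by (auto simp: edges)
    ultimately have "linked (mends H) {g \<in> medges H. cH g \<noteq> k} u (\<phi> a)"
      by (rule linked_mono)
    moreover have "a \<in> mverts K" using a multigraph_edge(2)[OF mK e(1)] by blast
    ultimately show ?thesis by blast
  qed
  have "good_colouring H cH"
    unfolding good_colouring_def
  proof (intro conjI ballI allI impI)
    show "cH ` medges H \<subseteq> {..<3}"
      using c cH by (auto simp: edges proper_3_edge_coloring_def)
  next
    fix u assume "u \<in> mverts H"
    then consider v where "v \<in> mverts K" "u = \<phi> v"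
      | e where "e \<in> medges K" "u \<in> inner_verts (pv e)"
      by (auto simp: verts)
    then show "mg_degree H u = 2 \<and> (\<exists>i. \<forall>e\<in>medges H. u \<in> mends H e \<longrightarrow> cH e = i) \<or>
       mg_degree H u = 3 \<and> inj_on cH {e \<in> medges H. u \<in> mends H e}"
    proof cases
      case 1 then show ?thesis using at_branch[of v] by (simp add: mg_degree_def)
    next
      case 2
      have "mg_degree H u = 2"
        using path_inner_degree[OF path[OF 2(1)] 2(2)] at_inner[OF 2] by (simp add: mg_degree_def)
      moreover have "\<forall>f\<in>medges H. u \<in> mends H f \<longrightarrow> cH f = c e"
        using at_inner[OF 2] cH[OF 2(1)] by blast
      ultimately show ?thesis by blast
    qed
  next
    fix k :: nat and e f u v
    assume *: "k < 3" "e \<in> medges H" "f \<in> medges H" "cH e \<noteq> k" "cH f \<noteq> k"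
      "u \<in> mends H e" "v \<in> mends H f"
    obtain a b where ab: "a \<in> mverts K" "b \<in> mverts K"
      "linked (mends H) {g \<in> medges H. cH g \<noteq> k} u (\<phi> a)"
      "linked (mends H) {g \<in> medges H. cH g \<noteq> k} v (\<phi> b)"
      using to_branch[OF *(2,4,6)] to_branch[OF *(3,5,7)] by blast
    have "linked (mends K) {e \<in> medges K. c e \<noteq> k} a b"
      by (rule kotzig_two_colours_connected[OF cubK c ham *(1) ab(1,2)])
    then have "linked (mends H) {g \<in> medges H. cH g \<noteq> k} (\<phi> a) (\<phi> b)"
      by (rule branch_linked)
    then show "linked (mends H) {g \<in> medges H. cH g \<noteq> k} u v"
      by (rule linked_trans[OF ab(3) linked_trans[OF _ linked_sym[OF ab(4)]]])
  qed
  then show "\<exists>c. good_colouring H c" by blast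
  obtain e where e: "e \<in> medges K" using long by blast
  obtain v where v: "v \<in> mends K e" using multigraph_edge(4)[OF mK e] by blast
  then have "v \<in> mverts K" using multigraph_edge(2)[OF mK e] by blast
  then show "\<exists>v\<in>mverts H. mg_degree H v = 3"
    using at_branch(1) by (auto simp: verts mg_degree_def)
qed

section \<open>Balancing the classes\<close>

text \<open>Passage to the multigraph obtained by contracting the classes of \<open>cls\<close>:
  an edge inside a class contributes 2 to the sum over that class, so only the edges between
  different classes matter modulo 2.\<close>

lemma class_sum_parity:
  assumes fin: "finite X" "finite V" and inc: "\<And>e. e \<in> X \<Longrightarrow> card (inc e) = 2 \<and> inc e \<subseteq> V"
  shows "even (\<Sum>v\<in>{v \<in> V. cls v = x}. edeg inc X v) \<longleftrightarrow>
    even (edeg (\<lambda>e. cls ` inc e) {e \<in> X. card (cls ` inc e) = 2} x)"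
proof -
  let ?Q = "{v \<in> V. cls v = x}"
  have "odd (card (inc e \<inter> ?Q)) \<longleftrightarrow> card (cls ` inc e) = 2 \<and> x \<in> cls ` inc e"
    if e: "e \<in> X" for e
  proof -
    obtain a b where ab: "inc e = {a, b}" "a \<noteq> b" using inc[OF e] by (auto simp: card_2_iff)
    have abV: "a \<in> V" "b \<in> V" using inc[OF e] ab by auto
    show ?thesis
    proof (cases "cls a = cls b")
      case True
      then have "inc e \<inter> ?Q = (if cls a = x then {a, b} else {})" using ab abV by auto
      then show ?thesis using ab True by simp
    next
      case False
      have "inc e \<inter> ?Q = (if cls a = x then {a} else if cls b = x then {b} else {})"
        using ab abV False by auto
      then show ?thesis using ab False by auto
    qed
  qed
  then have "{e \<in> X. odd (card (inc e \<inter> ?Q))} =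
      {e \<in> {e \<in> X. card (cls ` inc e) = 2}. x \<in> cls ` inc e}" by blast
  then show ?thesis
    using fin sum_edeg[of X ?Q inc] even_sum_iff[of X "\<lambda>e. card (inc e \<inter> ?Q)"]
    by (simp add: edeg_def)
qed

definition swapped :: "('v \<Rightarrow> 'c) \<Rightarrow> 'c set \<Rightarrow> ('v \<Rightarrow> nat) \<Rightarrow> 'v \<Rightarrow> nat" where
  "swapped cls S \<kappa> v = (if cls v \<in> S then transpose 1 2 (\<kappa> v) else \<kappa> v)"

lemma swapped_simps:
  "swapped cls S \<kappa> v = 0 \<longleftrightarrow> \<kappa> v = 0"
  "swapped cls S \<kappa> v < 3 \<longleftrightarrow> \<kappa> v < 3"
  by (auto simp: swapped_def transpose_def)

text \<open>Take \<open>S\<close> with as many free edges (equal nonzero colours at both ends) as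
  possible. If an edge without an end of colour 0 joined different classes of the graph of free
  edges, exchanging 1 and 2 throughout one of these classes would keep all free edges free, since
  none of them leaves the class, and would make the given edge free as well.\<close>

lemma swapping_connects:
  fixes cls :: "'v \<Rightarrow> 'c" and \<kappa> :: "'v \<Rightarrow> nat"
  assumes fin: "finite M"
    and inc: "\<And>e. e \<in> M \<Longrightarrow> card (inc e) = 2 \<and> card (cls ` inc e) = 2"
    and \<kappa>: "\<And>e v. e \<in> M \<Longrightarrow> v \<in> inc e \<Longrightarrow> \<kappa> v < 3"
  shows "\<exists>S. \<forall>e\<in>M. 0 \<notin> \<kappa> ` inc e \<longrightarrow> (\<forall>x\<in>cls ` inc e. \<forall>y\<in>cls ` inc e.
    linked (\<lambda>e. cls ` inc e) {e \<in> M. swapped cls S \<kappa> ` inc e \<in> {{1}, {2}}} x y)"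
proof -
  define free where "free S = {e \<in> M. swapped cls S \<kappa> ` inc e \<in> {{1}, {2}}}" for S
  let ?c = "\<lambda>e. cls ` inc e"
  have finfree: "finite (free S)" for S using fin by (simp add: free_def)
  have "card (free S) \<le> card M" for S
    using fin by (auto simp: free_def intro: card_mono)
  then obtain S where max: "\<And>S'. card (free S') \<le> card (free S)"
    using ex_has_greatest_nat[of "\<lambda>_. True" "{}" "\<lambda>S. card (free S)" "Suc (card M)"]
    by (auto simp: less_Suc_eq_le)
  have "linked ?c (free S) x y"
    if e: "e \<in> M" "0 \<notin> \<kappa> ` inc e" and xy: "x \<in> ?c e" "y \<in> ?c e" for e x y
  proof (rule ccontr)
    assume nl: "\<not> linked ?c (free S) x y"
    then have "x \<noteq> y" by auto
    obtain a b where a: "a \<in> inc e" "cls a = x" and b: "b \<in> inc e" "cls b = y"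
      using xy by blast
    have "a \<noteq> b" using a b \<open>x \<noteq> y\<close> by blast
    then have ab: "inc e = {a, b}" using inc[OF e(1)] a(1) b(1) by (auto simp: card_2_iff)
    have e_not_free: "e \<notin> free S"
      using nl linked_edge_ends[of e "free S" ?c x y] inc[OF e(1)] xy by auto
    define U where "U = {z. linked ?c (free S) x z}"
    define S' where "S' = (S - U) \<union> (U - S)"
    have sw: "swapped cls S' \<kappa> v =
        (if cls v \<in> U then transpose 1 2 (swapped cls S \<kappa> v) else swapped cls S \<kappa> v)" for v
      by (auto simp: swapped_def S'_def)
    have "free S \<subseteq> free S'"
    proof
      fix f assume f: "f \<in> free S"
      then have fM: "f \<in> M" by (simp add: free_def)
      have in_or_out: "?c f \<subseteq> U \<or> ?c f \<inter> U = {}"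
        using edge_within_linked_class[of "free S" ?c UNIV f x] inc f
        by (auto simp: free_def U_def)
      obtain i where i: "i = 1 \<or> i = 2" "swapped cls S \<kappa> ` inc f = {i}"
        using f by (auto simp: free_def)
      have "swapped cls S' \<kappa> ` inc f = (if ?c f \<subseteq> U then transpose 1 2 ` {i} else {i})"
      proof (cases "?c f \<subseteq> U")
        case True
        then have "swapped cls S' \<kappa> ` inc f = transpose 1 2 ` (swapped cls S \<kappa> ` inc f)"
          unfolding image_image by (intro image_cong) (auto simp: sw)
        then show ?thesis using True i(2) by simp
      next
        case False
        then have "swapped cls S' \<kappa> ` inc f = swapped cls S \<kappa> ` inc f"
          using in_or_out by (intro image_cong) (auto simp: sw)
        then show ?thesis using False i(2) by simp
      qed
      then show "f \<in> free S'" using fM i(1) by (auto simp: free_def)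
    qed
    moreover have "e \<in> free S'"
    proof -
      have "x \<in> U" "y \<notin> U" using nl by (auto simp: U_def)
      then have "swapped cls S' \<kappa> a = transpose 1 2 (swapped cls S \<kappa> a)"
        "swapped cls S' \<kappa> b = swapped cls S \<kappa> b" using a b sw by auto
      moreover have "swapped cls S \<kappa> a \<in> {1, 2}" "swapped cls S \<kappa> b \<in> {1, 2}"
      proof -
        have "swapped cls S \<kappa> v \<in> {1, 2}" if "v \<in> inc e" for v
        proof -
          have "\<kappa> v \<noteq> 0" using e(2) that by (metis image_eqI)
          then have "swapped cls S \<kappa> v \<noteq> 0" "swapped cls S \<kappa> v < 3"
            using \<kappa>[OF e(1) that] by (simp_all add: swapped_simps)
          then show ?thesis by auto
        qed
        then show "swapped cls S \<kappa> a \<in> {1, 2}" "swapped cls S \<kappa> b \<in> {1, 2}"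
          using a b by auto
      qed
      moreover have "swapped cls S \<kappa> a \<noteq> swapped cls S \<kappa> b"
        using e_not_free e(1) calculation by (auto simp: free_def ab)
      ultimately show ?thesis using e(1) by (auto simp: free_def ab)
    qed
    ultimately have "card (free S) < card (free S')"
      using e_not_free finfree by (intro psubset_card_mono) auto
    then show False using max[of S'] by simp
  qed
  then show ?thesis unfolding free_def by blast
qed

text \<open>Here \<open>\<kappa> v\<close> is the colour at the end \<open>v\<close> of an edge of
  \<open>M\<close>, the classes of \<open>cls\<close> are the components, and \<open>N\<close> is
  the family of those that the edges with two ends of colour 0 connect with each other. The value
  \<open>\<mu> e\<close> has to avoid the colours at both ends of \<open>e\<close>. Free edges
  decide between 0 and another value, edges with two ends of colour 0 decide between 1 and 2, and
  the two choices are made one after the other, each as a T-join.\<close>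

lemma balanced_partition:
  fixes cls :: "'v \<Rightarrow> 'c" and \<kappa> :: "'v \<Rightarrow> nat"
  assumes fin: "finite M" "finite V"
    and inc: "\<And>e. e \<in> M \<Longrightarrow> card (inc e) = 2 \<and> inc e \<subseteq> V"
    and \<kappa>: "\<And>e v. e \<in> M \<Longrightarrow> v \<in> inc e \<Longrightarrow> \<kappa> v < 3"
    and ev: "\<And>x. x \<in> cls ` V \<Longrightarrow> even (\<Sum>v\<in>{v \<in> V. cls v = x}. edeg inc M v)"
    and N: "N \<subseteq> cls ` V"
      "\<And>x y. x \<in> N \<Longrightarrow> y \<in> N \<Longrightarrow> linked (\<lambda>e. cls ` inc e)
         {e \<in> M. card (cls ` inc e) = 2 \<and> \<kappa> ` inc e = {0}} x y"
    and mono: "\<And>v. v \<in> V \<Longrightarrow> cls v \<notin> N \<Longrightarrow> \<kappa> v = 1"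
  shows "\<exists>S \<mu>. (\<forall>e\<in>M. \<mu> e < 3 \<and> (\<forall>v\<in>inc e. \<mu> e \<noteq> swapped cls S \<kappa> v)) \<and>
    (\<forall>x\<in>cls ` V. \<forall>k<3. even (\<Sum>v\<in>{v \<in> V. cls v = x}. edeg inc {e \<in> M. \<mu> e = k} v))"
proof -
  let ?c = "\<lambda>e. cls ` inc e"
  define W where "W = cls ` V"
  define M' where "M' = {e \<in> M. card (?c e) = 2}"
  have finW: "finite W" using fin by (simp add: W_def)
  have finM': "finite M'" using fin by (simp add: M'_def)
  have M': "e \<in> M" "card (?c e) = 2" "?c e \<subseteq> W" if "e \<in> M'" for e
    using that inc[of e] by (auto simp: M'_def W_def)
  have "card (inc e) = 2 \<and> card (?c e) = 2" "v \<in> inc e \<Longrightarrow> \<kappa> v < 3" if "e \<in> M'" for e v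
    using that inc \<kappa> by (auto simp: M'_def)
  then have "\<exists>S. \<forall>e\<in>M'. 0 \<notin> \<kappa> ` inc e \<longrightarrow> (\<forall>x\<in>?c e. \<forall>y\<in>?c e.
      linked ?c {e \<in> M'. swapped cls S \<kappa> ` inc e \<in> {{1}, {2}}} x y)"
    by (rule swapping_connects[OF finM'])
  then obtain S where S: "\<And>e x y. e \<in> M' \<Longrightarrow> 0 \<notin> \<kappa> ` inc e \<Longrightarrow> x \<in> ?c e \<Longrightarrow> y \<in> ?c e \<Longrightarrow>
      linked ?c {e \<in> M'. swapped cls S \<kappa> ` inc e \<in> {{1}, {2}}} x y"
    by meson
  define h where "h e = swapped cls S \<kappa> ` inc e" for e
  have h0: "0 \<in> h e \<longleftrightarrow> 0 \<in> \<kappa> ` inc e" for e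
    unfolding h_def image_iff by (metis swapped_simps(1))
  have h_card: "h e \<subseteq> {0, 1, 2}" "card (h e) \<le> 2" "h e \<noteq> {}" if "e \<in> M" for e
  proof -
    have "swapped cls S \<kappa> v < 3" if "v \<in> inc e" for v
      using \<kappa>[OF \<open>e \<in> M\<close> that] by (simp add: swapped_simps)
    then show "h e \<subseteq> {0, 1, 2}" unfolding h_def by fastforce
    show "card (h e) \<le> 2"
      using inc[OF that] card_image_le[of "inc e"] card_gt_0_iff[of "inc e"] by (auto simp: h_def)
    show "h e \<noteq> {}" using inc[OF that] by (auto simp: h_def)
  qed
  have h12: "h e = {1, 2}" if "e \<in> M" "1 \<in> h e" "2 \<in> h e" for e
  proof -
    have "finite (h e)" using h_card(1)[OF that(1)] finite_subset by blast
    then show ?thesis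
      using card_seteq[of "h e" "{1, 2}"] that h_card(2)[OF that(1)] by auto
  qed
  \<comment> \<open>Edges in \<open>free\<close> may be given value 0 or not; edges in
    \<open>mix\<close> must have value 0.\<close>
  define free where "free = {e \<in> M'. h e \<in> {{1}, {2}}}"
  define mix where "mix = {e \<in> M'. h e = {1, 2}}"
  have "\<exists>Z\<subseteq>free. \<forall>x\<in>W. even (edeg ?c Z x + edeg ?c mix x)"
  proof (rule T_join_exists)
    show "finite free" "finite W" using finM' finW by (simp_all add: free_def)
    show "card (?c e) = 2" "?c e \<subseteq> W" if "e \<in> free" for e
      using that M' by (auto simp: free_def)
    fix u assume "u \<in> W"
    show "even (\<Sum>x\<in>{x \<in> W. linked ?c free u x}. edeg ?c mix x)"
    proof (rule handshake)
      show "finite mix" "finite {x \<in> W. linked ?c free u x}"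
        using finM' finW by (simp_all add: mix_def)
      fix e assume "e \<in> mix"
      then have e: "e \<in> M'" "0 \<notin> \<kappa> ` inc e" using h0[of e] by (auto simp: mix_def)
      then show "card (?c e) = 2" using M' by blast
      have "linked ?c free x y" if "x \<in> ?c e" "y \<in> ?c e" for x y
        using S[OF e that] by (simp add: free_def h_def)
      then show "?c e \<subseteq> {x \<in> W. linked ?c free u x} \<or>
          ?c e \<inter> {x \<in> W. linked ?c free u x} = {}"
        using M'(3)[OF e(1)] linked_trans[of ?c free u] by blast
    qed
  qed
  then obtain Z0 where Z0: "Z0 \<subseteq> free" "\<And>x. x \<in> W \<Longrightarrow> even (edeg ?c Z0 x + edeg ?c mix x)"
    by blast
  define Y where "Y = {e \<in> M'. h e = {0}}"
  \<comment> \<open>The edges with value 1 apart from those that will be chosen in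
    \<open>Y\<close>.\<close>
  define B where "B = {e \<in> M'. 2 \<in> h e \<and> e \<notin> mix \<and> e \<notin> Z0}"
  have fins: "finite free" "finite mix" "finite Z0" "finite Y" "finite B"
    using finM' Z0(1) by (auto simp: free_def mix_def Y_def B_def intro: finite_subset)
  have evM': "even (edeg ?c M' x)" if "x \<in> W" for x
    using ev[of x] that class_sum_parity[of M V inc cls x] fin inc by (simp add: W_def M'_def)
  have Z0M': "Z0 \<subseteq> M'" "Z0 \<inter> mix = {}" using Z0(1) by (auto simp: free_def mix_def)
  have edeg_rest: "even (edeg ?c (M' - (mix \<union> Z0)) x)" if "x \<in> W" for x
  proof -
    have "edeg ?c (mix \<union> Z0) x + edeg ?c (M' - (mix \<union> Z0)) x = edeg ?c M' x"
      using Z0M' by (intro edeg_Diff finM') (auto simp: mix_def)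
    moreover have "edeg ?c (mix \<union> Z0) x = edeg ?c mix x + edeg ?c Z0 x"
      using Z0M' fins by (intro edeg_Un_disjoint) auto
    ultimately show ?thesis using evM'[OF that] Z0(2)[OF that] by (metis add.commute even_add)
  qed
  \<comment> \<open>A class outside \<open>N\<close> has one nonzero colour throughout. If this is
    1, no edge at the class has value 1; if it is 2, no edge at it has value 2, and its edges of
    value 1 are the complement of those of value 0.\<close>
  have evB: "even (edeg ?c B x)" if x: "x \<in> W" "x \<notin> N" for x
  proof (cases "x \<in> S")
    case True
    have "2 \<in> h e" if e: "e \<in> M'" "x \<in> ?c e" for e
    proof -
      obtain v where v: "v \<in> inc e" "cls v = x" using e by blast
      then have "\<kappa> v = 1" using mono x(2) inc M'(1)[OF e(1)] by blast
      then have "swapped cls S \<kappa> v = 2" using v True by (simp add: swapped_def)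
      then show ?thesis using v(1) unfolding h_def by (metis image_eqI)
    qed
    then have "{e \<in> B. x \<in> ?c e} = {e \<in> M' - (mix \<union> Z0). x \<in> ?c e}" by (auto simp: B_def)
    then show ?thesis using edeg_rest[OF x(1)] by (simp add: edeg_def)
  next
    case False
    have "x \<notin> ?c e" if e: "e \<in> B" for e
    proof
      assume "x \<in> ?c e"
      have eM': "e \<in> M'" using e by (simp add: B_def)
      obtain v where v: "v \<in> inc e" "cls v = x" using \<open>x \<in> ?c e\<close> by blast
      then have "\<kappa> v = 1" using mono x(2) inc M'(1)[OF eM'] by blast
      then have "swapped cls S \<kappa> v = 1" using v False by (simp add: swapped_def)
      then have "1 \<in> h e" using v(1) unfolding h_def by (metis image_eqI)
      then have "e \<in> mix" using h12[OF M'(1)[OF eM']] e by (simp add: B_def mix_def)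
      then show False using e by (simp add: B_def)
    qed
    then have "edeg ?c B x = 0" using fins(5) by (simp add: edeg_eq_0_iff)
    then show ?thesis by simp
  qed
  have YN: "?c e \<subseteq> N" if e: "e \<in> Y" for e
  proof
    fix x assume "x \<in> ?c e"
    then obtain v where v: "v \<in> inc e" "cls v = x" by blast
    have "swapped cls S \<kappa> v = 0" using e v(1) by (auto simp: Y_def h_def)
    then have "\<kappa> v = 0" by (simp add: swapped_simps)
    then show "x \<in> N" using mono[of v] v inc[of e] M'(1)[of e] e by (auto simp: Y_def)
  qed
  have Y_eq: "Y = {e \<in> M. card (?c e) = 2 \<and> \<kappa> ` inc e = {0}}"
  proof -
    have "f ` inc e = {0} \<longleftrightarrow> inc e \<noteq> {} \<and> (\<forall>v\<in>inc e. f v = 0)" for f :: "'v \<Rightarrow> nat" and e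
      by auto
    then have "h e = {0} \<longleftrightarrow> \<kappa> ` inc e = {0}" for e
      unfolding h_def by (simp add: swapped_simps)
    then show ?thesis by (auto simp: Y_def M'_def)
  qed
  have "\<exists>Z\<subseteq>Y. \<forall>x\<in>W. even (edeg ?c Z x + edeg ?c B x)"
  proof (rule T_join_exists)
    show "finite Y" "finite W" using fins finW by simp_all
    show "card (?c e) = 2" "?c e \<subseteq> W" if "e \<in> Y" for e
      using that M' by (auto simp: Y_def)
    fix u assume u: "u \<in> W"
    show "even (\<Sum>x\<in>{x \<in> W. linked ?c Y u x}. edeg ?c B x)"
    proof (cases "u \<in> N")
      case True
      have "{x \<in> W. linked ?c Y u x} = N"
        using linked_closed[of ?c Y u _ N] True YN N(2)[OF True] N(1) by (auto simp: Y_eq W_def)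
      moreover have "even (\<Sum>x\<in>W. edeg ?c B x)"
        using fins finW M' by (intro handshake) (auto simp: B_def)
      moreover have "(\<Sum>x\<in>W. edeg ?c B x) = (\<Sum>x\<in>W - N. edeg ?c B x) + (\<Sum>x\<in>N. edeg ?c B x)"
        using N(1) finW by (intro sum.subset_diff) (auto simp: W_def)
      moreover have "even (\<Sum>x\<in>W - N. edeg ?c B x)"
        using evB by (intro dvd_sum) auto
      ultimately show ?thesis by simp
    next
      case False
      have "x = u" if "linked ?c Y u x" for x
        using linked_closed[OF that, of "{u}"] False YN by blast
      then have "{x \<in> W. linked ?c Y u x} = {u}" using u by auto
      then show ?thesis using evB[OF u False] by simp
    qed
  qed
  then obtain Z1 where Z1: "Z1 \<subseteq> Y" "\<And>x. x \<in> W \<Longrightarrow> even (edeg ?c Z1 x + edeg ?c B x)"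
    by blast
  define \<mu> :: "_ \<Rightarrow> nat" where
    "\<mu> e = (if h e = {1, 2} \<or> e \<in> Z0 then 0 else if 2 \<in> h e \<or> e \<in> Z1 then 1 else 2)" for e
  have avoid: "\<mu> e < 3 \<and> (\<forall>v\<in>inc e. \<mu> e \<noteq> swapped cls S \<kappa> v)" if e: "e \<in> M" for e
  proof -
    have "\<mu> e \<notin> h e"
    proof -
      consider "h e = {1, 2}" | "e \<in> Z0" | "h e \<noteq> {1, 2}" "e \<notin> Z0" "2 \<in> h e"
        | "e \<notin> Z0" "2 \<notin> h e" "e \<in> Z1" | "h e \<noteq> {1, 2}" "e \<notin> Z0" "2 \<notin> h e" "e \<notin> Z1"
        by blast
      then show ?thesis
      proof cases
        case 1 then show ?thesis by (simp add: \<mu>_def)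
      next
        case 2
        then have "h e = {1} \<or> h e = {2}" using Z0(1) by (auto simp: free_def)
        then show ?thesis using 2 by (auto simp: \<mu>_def)
      next
        case 3
        then have "1 \<notin> h e" using h12[OF e] by blast
        then show ?thesis using 3 by (simp add: \<mu>_def)
      next
        case 4
        then have "h e = {0}" using Z1(1) by (auto simp: Y_def)
        then show ?thesis using 4 by (simp add: \<mu>_def)
      next
        case 5 then show ?thesis by (simp add: \<mu>_def)
      qed
    qed
    moreover have "\<mu> e < 3" by (simp add: \<mu>_def)
    ultimately show ?thesis unfolding h_def by (metis image_eqI)
  qed
  have evk: "even (edeg ?c {e \<in> M'. \<mu> e = k} x)" if x: "x \<in> W" and k: "k < 3" for x k
  proof -
    have 0: "{e \<in> M'. \<mu> e = 0} = Z0 \<union> mix" using Z0M' by (auto simp: \<mu>_def mix_def)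
    have Z1h: "e \<in> M'" "h e = {0}" if "e \<in> Z1" for e using Z1(1) that by (auto simp: Y_def)
    have "e \<notin> Z0" if "e \<in> Z1" for e
      using Z0(1) Z1h(2)[OF that] by (auto simp: free_def)
    then have 1: "{e \<in> M'. \<mu> e = 1} = Z1 \<union> B"
      using Z1h by (auto simp: \<mu>_def B_def mix_def)
    have finZ1: "finite Z1" using Z1(1) fins finite_subset by blast
    have ev0: "even (edeg ?c {e \<in> M'. \<mu> e = 0} x)"
      unfolding 0 using Z0(2)[OF x] edeg_Un_disjoint[of Z0 mix ?c x] Z0M' fins by simp
    have "Z1 \<inter> B = {}" using Z1(1) by (auto simp: Y_def B_def)
    then have ev1: "even (edeg ?c {e \<in> M'. \<mu> e = 1} x)"
      unfolding 1 using Z1(2)[OF x] edeg_Un_disjoint[of Z1 B ?c x] finZ1 fins by simp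
    have "M' = {e \<in> M'. \<mu> e = 0} \<union> ({e \<in> M'. \<mu> e = 1} \<union> {e \<in> M'. \<mu> e = 2})"
      by (auto simp: \<mu>_def)
    then have "edeg ?c M' x = edeg ?c ({e \<in> M'. \<mu> e = 0} \<union> ({e \<in> M'. \<mu> e = 1} \<union> {e \<in> M'. \<mu> e = 2})) x"
      by simp
    also have "\<dots> = edeg ?c {e \<in> M'. \<mu> e = 0} x +
        (edeg ?c {e \<in> M'. \<mu> e = 1} x + edeg ?c {e \<in> M'. \<mu> e = 2} x)"
      using finM' by (subst edeg_Un_disjoint; (subst edeg_Un_disjoint)?) auto
    finally have ev2: "even (edeg ?c {e \<in> M'. \<mu> e = 2} x)"
      using evM'[OF x] ev0 ev1 by simp
    have "k = 0 \<or> k = 1 \<or> k = 2" using k by auto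
    then show ?thesis using ev0 ev1 ev2 by blast
  qed
  have "even (\<Sum>v\<in>{v \<in> V. cls v = x}. edeg inc {e \<in> M. \<mu> e = k} v)"
    if "x \<in> cls ` V" "k < 3" for x k
  proof -
    have "{e \<in> {e \<in> M. \<mu> e = k}. card (?c e) = 2} = {e \<in> M'. \<mu> e = k}" by (auto simp: M'_def)
    then show ?thesis
      using evk[of x k] that class_sum_parity[of "{e \<in> M. \<mu> e = k}" V inc cls x] fin inc
      by (simp add: W_def)
  qed
  then show ?thesis using avoid by blast
qed

section \<open>The contracted graph\<close>

locale spanning_subgraph =
  fixes G F :: "('v, 'e) mgraph"
  assumes G: "multigraph G" and F: "mg_subgraph F G" and span: "mverts F = mverts G"
begin

lemma multigraph_F: "multigraph F" and ends_F: "mends F = mends G" and edges_F: "medges F \<subseteq> medges G"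
  using F by (simp_all add: mg_subgraph_def)

lemma comps: "mg_components F = component F ` mverts G"
  using mg_components_eq[OF multigraph_F] span by simp

lemma in_component_iff:
  assumes "H \<in> mg_components F" "v \<in> mverts G"
  shows "v \<in> mverts H \<longleftrightarrow> component F v = H"
proof
  obtain u where u: "H = component F u" using assms(1) comps by blast
  show "component F v = H" if "v \<in> mverts H" using component_eq[of v F u] that u by simp
  show "v \<in> mverts H" if "component F v = H"
    using in_component_self[of v F] that assms(2) span by simp
qed

lemma component_verts:
  assumes "H \<in> mg_components F"
  shows "mverts H = {v \<in> mverts G. component F v = H}"
proof -
  have "mverts H \<subseteq> mverts G"
    using assms F unfolding mg_components_def mg_subgraph_def by auto
  then show ?thesis using in_component_iff[OF assms] by blast
qed

lemma edge_in_component: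
  assumes "e \<in> medges F" "v \<in> mends G e"
  shows "e \<in> medges (component F v)"
proof -
  have "v \<in> mverts F" using multigraph_edge(2)[OF multigraph_F assms(1)] assms(2) ends_F by auto
  then show ?thesis
    using component_edge[OF multigraph_F assms(1)] assms(2) in_component_self[of v F] ends_F by metis
qed

lemma component_constant_on_edge:
  assumes "e \<in> medges F" "v \<in> mends G e" "w \<in> mends G e"
  shows "component F v = component F w"
proof -
  have e: "e \<in> medges (component F w)" using edge_in_component assms by blast
  have "v \<in> mverts F" using multigraph_edge(2)[OF multigraph_F assms(1)] assms(2) ends_F by auto
  then have "v \<in> mverts (component F w)"
    using e assms(2) ends_F by (auto simp: component_simps)
  then show ?thesis by (rule component_eq)
qed

lemma contracted_ends:
  assumes "e \<in> medges G"
  shows "mends (contracted G F) e = component F ` mends G e"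
proof -
  have "mends G e \<inter> mverts H \<noteq> {} \<longleftrightarrow> H \<in> component F ` mends G e"
    if "H \<in> mg_components F" for H
    using in_component_iff[OF that] multigraph_edge(2)[OF G assms] by blast
  moreover have "component F ` mends G e \<subseteq> mg_components F"
    using comps multigraph_edge(2)[OF G assms] by blast
  ultimately show ?thesis by (auto simp: contracted_def)
qed

lemma contracted_edges:
  "medges (contracted G F) = {e \<in> medges G. card (component F ` mends G e) = 2}"
proof -
  have "(\<exists>H\<in>mg_components F. mends G e \<subseteq> mverts H) \<longleftrightarrow> card (component F ` mends G e) \<noteq> 2"
    if e: "e \<in> medges G" for e
  proof -
    obtain a b where ab: "mends G e = {a, b}" "a \<noteq> b"
      using multigraph_edge(1)[OF G e] by (auto simp: card_2_iff)
    have V: "a \<in> mverts G" "b \<in> mverts G" using multigraph_edge(2)[OF G e] ab by auto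
    have "(\<exists>H\<in>mg_components F. mends G e \<subseteq> mverts H) \<longleftrightarrow> component F a = component F b"
      using V in_component_iff[OF _ V(1)] in_component_iff[OF _ V(2)] comps ab by auto
    then show ?thesis using ab by auto
  qed
  then show ?thesis by (auto simp: contracted_def)
qed

lemma contracted_verts: "mverts (contracted G F) = mg_components F"
  by (simp add: contracted_def)

lemma contracted_edge_not_in_F:
  assumes "e \<in> medges (contracted G F)" shows "e \<in> medges G - medges F"
proof -
  have e: "e \<in> medges G" "card (component F ` mends G e) = 2"
    using assms contracted_edges by auto
  obtain a b where ab: "mends G e = {a, b}" "a \<noteq> b"
    using multigraph_edge(1)[OF G e(1)] by (auto simp: card_2_iff)
  have "component F a \<noteq> component F b" using e(2) ab by auto
  then show ?thesis using e(1) component_constant_on_edge[of e a b] ab by auto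
qed

end

section \<open>Kotzig frames with a connected core\<close>

lemma card_2_ends:
  assumes "card A = 2" "v \<in> A" shows "\<exists>w. A = {v, w} \<and> w \<noteq> v"
  using assms by (auto simp: card_2_iff)

lemma C_vertices_K_vertices_disjoint: "C_vertices F \<inter> K_vertices F = {}"
proof -
  have False if H: "is_cycle H" "subdivided_kotzig H" for H :: "('v, 'e) mgraph"
  proof -
    obtain v where "v \<in> mverts H" "mg_degree H v = 3"
      using subdivided_kotzig_colouring(2)[OF H(2)] by blast
    then show False using H(1) by (auto simp: is_cycle_def mg_regular_def)
  qed
  then show ?thesis by (auto simp: C_vertices_def K_vertices_def)
qed

text \<open>What has to be arranged is a good colouring of each component such that the core and
  the Kotzig components become connected through edges with two ends of colour 0.\<close>

theorem core_connected_imp_6_cdc: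
  fixes G F :: "('v, 'e) mgraph"
  assumes cub: "cubic_graph G" and frame: "kotzig_frame G F"
    and C': "C' \<subseteq> C_vertices F" "mg_connected (mg_induced (contracted G F) C')"
    and near: "K_vertices F \<subseteq> mg_neighbors (contracted G F) C'"
  shows "has_k_cdc 6 G"
proof -
  have mG: "multigraph G" using cub by (simp add: cubic_graph_def)
  interpret spanning_subgraph G F
    using mG frame by unfold_locales (simp_all add: kotzig_frame_def)
  define V where "V = mverts G"
  define cls where "cls = component F"
  define M where "M = medges G - medges F"
  have fin: "finite (medges G)" "finite V" "finite (medges F)" "finite M"
    using mG multigraph_F by (simp_all add: multigraph_def V_def M_def)
  have deg3: "edeg (mends G) M v + edeg (mends G) (medges F) v = 3" if "v \<in> V" for v
    using edeg_Diff[OF fin(1) edges_F, of "mends G" v] cub that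
    by (simp add: M_def V_def cubic_graph_def mg_regular_def mg_degree_eq_edeg)
  have cls_comp: "cls v \<in> mg_components F" if "v \<in> V" for v
    using comps that by (simp add: cls_def V_def)
  have comp_H: "H = cls v" "multigraph H" "mends H = mends G" "mg_degree H v = edeg (mends G) (medges F) v"
    "medges H \<subseteq> medges F"
    if "H \<in> mg_components F" "v \<in> mverts H" "v \<in> V" for H v
  proof -
    show H: "H = cls v" using in_component_iff that by (simp add: cls_def V_def)
    show "multigraph H" "mends H = mends G" "medges H \<subseteq> medges F"
      using component_subgraph[OF multigraph_F, of v] H ends_F
      by (auto simp: cls_def mg_subgraph_def)
    then show "mg_degree H v = edeg (mends G) (medges F) v"
      using edeg_component[OF multigraph_F, of v v] that(2) H ends_F
      by (simp add: mg_degree_eq_edeg cls_def)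
  qed
  have self: "v \<in> mverts (cls v)" if "v \<in> V" for v
    using in_component_self[of v F] that span by (simp add: cls_def V_def)
  have types: "H \<in> C_vertices F \<or> H \<in> K_vertices F" if "H \<in> mg_components F" for H
    using frame that by (auto simp: kotzig_frame_def C_vertices_def K_vertices_def)
  have disj: "H \<notin> C'" if "H \<in> K_vertices F" for H
    using C_vertices_K_vertices_disjoint[of F] C'(1) that by blast

  define attached where "attached H c \<longleftrightarrow> (\<exists>e v w. e \<in> medges (contracted G F) \<and> mends G e = {v, w} \<and>
      cls v = H \<and> cls w \<in> C' \<and> (\<forall>f\<in>medges H. v \<in> mends G f \<longrightarrow> c f = 0))" for H and c :: "'e \<Rightarrow> nat"
  have K_col: "\<exists>c. good_colouring H c \<and> attached H c" if H: "H \<in> K_vertices F" for H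
  proof -
    have Hc: "H \<in> mg_components F" and HK: "subdivided_kotzig H"
      using H by (auto simp: K_vertices_def)
    obtain c where c: "good_colouring H c" using subdivided_kotzig_colouring(1)[OF HK] by blast
    obtain D where D: "D \<in> C'" "mg_adjacent (contracted G F) D H"
      using near H by (auto simp: mg_neighbors_def)
    then obtain e where e: "e \<in> medges (contracted G F)" "mends (contracted G F) e = {D, H}"
      by (auto simp: mg_adjacent_def)
    have eM: "e \<in> M" using contracted_edge_not_in_F[OF e(1)] by (simp add: M_def)
    then have eG: "e \<in> medges G" by (simp add: M_def)
    have img: "cls ` mends G e = {D, H}" using contracted_ends[OF eG] e(2) by (simp add: cls_def)
    then have "H \<in> cls ` mends G e" by simp
    then obtain v where v: "v \<in> mends G e" "cls v = H" by (elim imageE) simp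
    obtain w where w: "mends G e = {v, w}"
      using card_2_ends[OF multigraph_edge(1)[OF mG eG] v(1)] by blast
    have "D \<noteq> H" using D(1) disj[OF H] by blast
    then have wD: "cls w = D" using img w v(2) by auto
    have vV: "v \<in> V" using multigraph_edge(2)[OF mG eG] v(1) by (auto simp: V_def)
    have vH: "v \<in> mverts H" using self[OF vV] v(2) by simp
    note H_facts = comp_H[OF Hc vH vV]
    have "edeg (mends G) M v \<noteq> 0" using eM v(1) fin(4) by (auto simp: edeg_eq_0_iff)
    \<comment> \<open>An end of an edge outside \<open>F\<close> has degree 2 in its component, so
      it has a well-defined colour, which a transposition moves to 0.\<close>
    then have "mg_degree H v \<noteq> 3" using deg3[OF vV] H_facts(4) by simp
    then obtain i where i: "mg_degree H v = 2" "\<forall>f\<in>medges H. v \<in> mends H f \<longrightarrow> c f = i"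
      using good_colouring_at[OF c vH] by auto
    have "{f \<in> medges H. v \<in> mends H f} \<noteq> {}"
      using i(1) unfolding mg_degree_def by (metis card.empty zero_neq_numeral)
    then obtain f where "f \<in> medges H" "c f = i" using i(2) by blast
    then have "i < 3" using c by (auto simp: good_colouring_def)
    then have "transpose i 0 ` {..<3} = {..<3}" by (simp add: transpose_image_eq)
    then have "good_colouring H (transpose i 0 \<circ> c)"
      using good_colouring_permute[OF c, of "transpose i 0"] by simp
    moreover have "attached H (transpose i 0 \<circ> c)"
      unfolding attached_def using e(1) w v(2) wD D(1) i(2) H_facts(3)
      by (intro exI[of _ e] exI[of _ v] exI[of _ w]) simp
    ultimately show ?thesis by blast
  qed

  have "\<exists>c. good_colouring H c \<and> (H \<in> C' \<longrightarrow> c = (\<lambda>_. 0)) \<and>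
      (H \<in> K_vertices F \<longrightarrow> attached H c) \<and> (H \<notin> C' \<union> K_vertices F \<longrightarrow> c = (\<lambda>_. 1))"
    if H: "H \<in> mg_components F" for H
  proof (cases "H \<in> K_vertices F")
    case True then show ?thesis using K_col disj by blast
  next
    case False
    then have cyc: "is_cycle H" using types[OF H] by (simp add: C_vertices_def)
    show ?thesis
    proof (cases "H \<in> C'")
      case C: True
      then show ?thesis using False good_colouring_cycle[OF cyc, of 0]
        by (intro exI[of _ "\<lambda>_. 0"]) simp
    next
      case nC: False
      then show ?thesis using False good_colouring_cycle[OF cyc, of 1]
        by (intro exI[of _ "\<lambda>_. 1"]) simp
    qed
  qed
  then obtain cc where cc: "\<And>H. H \<in> mg_components F \<Longrightarrow> good_colouring H (cc H) \<and>
      (H \<in> C' \<longrightarrow> cc H = (\<lambda>_. 0)) \<and> (H \<in> K_vertices F \<longrightarrow> attached H (cc H)) \<and>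
      (H \<notin> C' \<union> K_vertices F \<longrightarrow> cc H = (\<lambda>_. 1))"
    by metis

  \<comment> \<open>Any edge of \<open>F\<close> at \<open>v\<close> shows the colour of
    \<open>v\<close>, as long as \<open>v\<close> is an end of an edge of
    \<open>M\<close>.\<close>
  define fe where "fe v = (SOME f. f \<in> medges (cls v) \<and> v \<in> mends G f)" for v
  have fe: "fe v \<in> medges (cls v)" "v \<in> mends G (fe v)" if "v \<in> V" for v
  proof -
    note H_facts = comp_H[OF cls_comp[OF that] self[OF that] that]
    have "mg_degree (cls v) v \<noteq> 0"
      using good_colouring_at[OF _ self[OF that]] cc[OF cls_comp[OF that]] by fastforce
    then have "{f \<in> medges (cls v). v \<in> mends G f} \<noteq> {}"
      using H_facts(3) unfolding mg_degree_def by (metis card.empty)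
    then have "\<exists>f. f \<in> medges (cls v) \<and> v \<in> mends G f" by blast
    then show "fe v \<in> medges (cls v)" "v \<in> mends G (fe v)"
      unfolding fe_def by (metis (mono_tags, lifting) someI_ex)+
  qed
  define \<kappa> where "\<kappa> v = cc (cls v) (fe v)" for v
  define N where "N = C' \<union> K_vertices F"
  have M_edge: "card (mends G e) = 2" "mends G e \<subseteq> V" if "e \<in> M" for e
    using multigraph_edge[OF mG, of e] that by (auto simp: M_def V_def)
  have N_comps: "N \<subseteq> mg_components F"
    using C' by (auto simp: N_def K_vertices_def C_vertices_def)

  let ?zero = "{e \<in> M. card (cls ` mends G e) = 2 \<and> \<kappa> ` mends G e = {0}}"
  let ?c = "\<lambda>e. cls ` mends G e"
  have \<kappa>_C': "\<kappa> v = 0" if "v \<in> V" "cls v \<in> C'" for v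
    using cc[OF cls_comp[OF that(1)]] that(2) by (simp add: \<kappa>_def)
  have linked_C': "linked ?c ?zero x y" if "x \<in> C'" "y \<in> C'" for x y
  proof -
    define I where "I = mg_induced (contracted G F) C'"
    have "C' \<subseteq> mg_components F" using N_comps by (auto simp: N_def)
    then have "linked (mends I) (medges I) x y"
      using C'(2) that unfolding mg_connected_iff_linked I_def
      by (auto simp: mg_induced_def contracted_verts)
    then show ?thesis
      unfolding linked_def
    proof (rule rtranclp_mono[THEN predicate2D, rotated], intro le_funI le_boolI)
      fix p q assume "\<exists>e\<in>medges I. mends I e = {p, q}"
      then obtain e where "e \<in> medges I" "mends I e = {p, q}" by blast
      then have e: "e \<in> medges (contracted G F)" "mends (contracted G F) e = {p, q}"
        "{p, q} \<subseteq> C'"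
        by (auto simp: I_def mg_induced_def)
      have eM: "e \<in> M" using contracted_edge_not_in_F[OF e(1)] by (simp add: M_def)
      have img: "?c e = {p, q}"
        using contracted_ends[of e] e(2) eM by (simp add: cls_def M_def)
      have "\<kappa> v = 0" if "v \<in> mends G e" for v
        using \<kappa>_C'[of v] M_edge(2)[OF eM] that img e(3) by blast
      moreover have "mends G e \<noteq> {}" using M_edge(1)[OF eM] by auto
      ultimately have "\<kappa> ` mends G e = {0}" by auto
      moreover have "card (?c e) = 2" using e(1) contracted_edges by (simp add: cls_def)
      ultimately show "\<exists>e\<in>?zero. ?c e = {p, q}" using eM img by blast
    qed
  qed
  have linked_K: "\<exists>y\<in>C'. linked ?c ?zero x y" if x: "x \<in> K_vertices F" for x
  proof -
    have "x \<in> mg_components F" using x by (simp add: K_vertices_def)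
    then have "attached x (cc x)" using cc x by blast
    then obtain e v w where e: "e \<in> medges (contracted G F)" "mends G e = {v, w}"
      "cls v = x" "cls w \<in> C'" "\<forall>f\<in>medges x. v \<in> mends G f \<longrightarrow> cc x f = 0"
      unfolding attached_def by blast
    have eM: "e \<in> M" using contracted_edge_not_in_F[OF e(1)] by (simp add: M_def)
    have vw: "v \<in> V" "w \<in> V" using M_edge(2)[OF eM] e(2) by auto
    have "\<kappa> v = 0" using fe[OF vw(1)] e(3,5) by (simp add: \<kappa>_def)
    moreover have "\<kappa> w = 0" using \<kappa>_C'[OF vw(2) e(4)] .
    moreover have "card (?c e) = 2" using e(1) contracted_edges by (simp add: cls_def)
    ultimately have "e \<in> ?zero" using eM e(2) by auto
    then have "linked ?c ?zero x (cls w)"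
      using e(2,3) by (intro linked_edge[of e]) auto
    then show ?thesis using e(4) by blast
  qed
  have linked_N: "linked ?c ?zero x y" if xy: "x \<in> N" "y \<in> N" for x y
  proof -
    have to_C': "\<exists>z\<in>C'. linked ?c ?zero x z" if "x \<in> N" for x
      using that linked_K[of x] linked_refl[of ?c ?zero x] unfolding N_def by blast
    obtain x' where x': "x' \<in> C'" "linked ?c ?zero x x'" using to_C'[OF xy(1)] by blast
    obtain y' where y': "y' \<in> C'" "linked ?c ?zero y y'" using to_C'[OF xy(2)] by blast
    show ?thesis
      by (rule linked_trans[OF x'(2) linked_trans[OF linked_C'[OF x'(1) y'(1)] linked_sym[OF y'(2)]]])
  qed

  have verts_cls: "{v \<in> V. cls v = x} = mverts x" if "x \<in> mg_components F" for x
    using component_verts[OF that] by (simp add: cls_def V_def)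
  have comps_V: "cls ` V = mg_components F" using comps by (simp add: cls_def V_def)
  \<comment> \<open>The component has even order and all degrees are 3, while the edges of
    \<open>F\<close> contribute an even number.\<close>
  have even_M: "even (\<Sum>v\<in>{v \<in> V. cls v = x}. edeg (mends G) M v)" if x: "x \<in> cls ` V" for x
  proof -
    have xc: "x \<in> mg_components F" using x comps_V by simp
    let ?Q = "{v \<in> V. cls v = x}"
    have "even (\<Sum>v\<in>?Q. edeg (mends G) (medges F) v)"
    proof (rule handshake)
      show "finite (medges F)" "finite ?Q" using fin by auto
      fix e assume e: "e \<in> medges F"
      then show "card (mends G e) = 2" using multigraph_edge(1)[OF mG] edges_F by blast
      have "mends G e \<subseteq> V" using multigraph_edge(2)[OF mG] edges_F e by (auto simp: V_def)
      then show "mends G e \<subseteq> ?Q \<or> mends G e \<inter> ?Q = {}"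
        using component_constant_on_edge[OF e] unfolding cls_def by blast
    qed
    moreover have sum: "(\<Sum>v\<in>?Q. edeg (mends G) M v) + (\<Sum>v\<in>?Q. edeg (mends G) (medges F) v) = 3 * card ?Q"
      using deg3 by (simp add: sum.distrib[symmetric])
    moreover have "even (card ?Q)"
      using frame xc verts_cls[OF xc] by (auto simp: kotzig_frame_def)
    ultimately have "even (\<Sum>v\<in>?Q. edeg (mends G) (medges F) v)" "even (3 * card ?Q)" by simp_all
    then show ?thesis unfolding sum[symmetric] by simp
  qed
  have \<kappa>3: "\<kappa> v < 3" if "v \<in> V" for v
    using cc[OF cls_comp[OF that]] fe(1)[OF that] unfolding good_colouring_def \<kappa>_def by blast
  have "\<exists>S \<mu>. (\<forall>e\<in>M. \<mu> e < 3 \<and> (\<forall>v\<in>mends G e. \<mu> e \<noteq> swapped cls S \<kappa> v)) \<and>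
    (\<forall>x\<in>cls ` V. \<forall>k<3. even (\<Sum>v\<in>{v \<in> V. cls v = x}. edeg (mends G) {e \<in> M. \<mu> e = k} v))"
  proof (rule balanced_partition[where N = N])
    show "\<kappa> v = 1" if "v \<in> V" "cls v \<notin> N" for v
      using cc[OF cls_comp[OF that(1)]] that(2) by (simp add: \<kappa>_def N_def)
  qed (use fin M_edge \<kappa>3 even_M N_comps comps_V linked_N in auto)
  then obtain S and \<mu> :: "'e \<Rightarrow> nat" where
    \<mu>: "\<And>e. e \<in> M \<Longrightarrow> \<mu> e < 3" "\<And>e v. e \<in> M \<Longrightarrow> v \<in> mends G e \<Longrightarrow> \<mu> e \<noteq> swapped cls S \<kappa> v"
    and balanced: "\<And>x k. x \<in> cls ` V \<Longrightarrow> k < 3 \<Longrightarrow>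
      even (\<Sum>v\<in>{v \<in> V. cls v = x}. edeg (mends G) {e \<in> M. \<mu> e = k} v)"
    by blast

  \<comment> \<open>The final colouring: colours 1 and 2 are exchanged in the components in
    \<open>S\<close>.\<close>
  define cc' where "cc' H = (if H \<in> S then transpose 1 2 \<circ> cc H else cc H)" for H
  have good': "good_colouring H (cc' H)" if "H \<in> mg_components F" for H
    using cc[OF that] good_colouring_permute[of H "cc H" "transpose 1 2"]
    by (simp add: cc'_def transpose_image_eq)
  have \<kappa>': "swapped cls S \<kappa> v = cc' (cls v) (fe v)" for v
    by (simp add: swapped_def \<kappa>_def cc'_def)
  define c where "c e = cc' (cls (SOME v. v \<in> mends G e)) e" for e
  have c: "c e = cc' (cls v) e" if "e \<in> medges F" "v \<in> mends G e" for e v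
  proof -
    have "(SOME v. v \<in> mends G e) \<in> mends G e" using that(2) by (rule someI)
    then show ?thesis
      using component_constant_on_edge[OF that(1) _ that(2)] by (simp add: c_def cls_def)
  qed
  have F_at: "e \<in> medges F \<longleftrightarrow> e \<in> medges (cls v)" if "v \<in> V" "v \<in> mends G e" for e v
    using edge_in_component[of e v] comp_H(5)[OF cls_comp self that(1)] that by (auto simp: cls_def)
  define R where "R k = {e \<in> medges F. c e \<noteq> k}" for k
  have R_at: "{e \<in> R k. v \<in> mends G e} = {e \<in> medges (cls v). cc' (cls v) e \<noteq> k \<and> v \<in> mends G e}"
    if "v \<in> V" for k v
    using F_at[OF that] c by (auto simp: R_def)
  have finR: "finite (R k)" for k using fin(3) by (simp add: R_def)
  have c3: "c e < 3" if e: "e \<in> medges F" for e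
  proof -
    obtain v where v: "v \<in> mends G e" using multigraph_edge(4)[OF mG] edges_F e by blast
    have vV: "v \<in> V" using multigraph_edge(2)[OF mG] edges_F e v by (auto simp: V_def)
    show ?thesis
      using good'[OF cls_comp[OF vV]] F_at[OF vV v] e c[OF e v] unfolding good_colouring_def by auto
  qed
  have even_R: "even (edeg (mends G) (R k) v)" if k: "k < 3" and v: "v \<in> V" for k v
  proof -
    note H_facts = comp_H[OF cls_comp[OF v] self[OF v] v]
    have "edeg (mends G) (R k) v = edeg (mends (cls v)) {e \<in> medges (cls v). cc' (cls v) e \<noteq> k} v"
      using R_at[OF v, of k] H_facts(3) by (simp add: edeg_def)
    then show ?thesis
      using good_colouring_even[OF good'[OF cls_comp[OF v]] H_facts(2) self[OF v] k] by simp
  qed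
  \<comment> \<open>A vertex missed by \<open>R k\<close> has colour \<open>k\<close>, which the
    class of an edge at that vertex avoids.\<close>
  have no_M: "edeg (mends G) {e \<in> M. \<mu> e = k} v = 0"
    if v: "v \<in> V" and none: "\<And>e. e \<in> R k \<Longrightarrow> v \<notin> mends G e" for k v
  proof (rule ccontr)
    assume "edeg (mends G) {e \<in> M. \<mu> e = k} v \<noteq> 0"
    then obtain e where e: "e \<in> M" "\<mu> e = k" "v \<in> mends G e"
      using fin(4) by (auto simp: edeg_eq_0_iff)
    have "fe v \<notin> R k" using none fe(2)[OF v] by blast
    then have "cc' (cls v) (fe v) = k"
      using fe[OF v] F_at[OF v fe(2)[OF v]] c[of "fe v" v] by (simp add: R_def)
    then show False using \<mu>(2)[OF e(1,3)] e(2) \<kappa>'[of v] by simp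
  qed
  have par: "even (\<Sum>w\<in>{w \<in> V. linked (mends G) (R k) v w}. edeg (mends G) {e \<in> M. \<mu> e = k} w)"
    if k: "k < 3" and v: "v \<in> V" for k v
  proof (cases "\<exists>e\<in>R k. v \<in> mends G e")
    case False
    have "w = v" if "linked (mends G) (R k) v w" for w
      using linked_closed[OF that, of "{v}"] False by blast
    then have "{w \<in> V. linked (mends G) (R k) v w} = {v}" using v by auto
    then show ?thesis using no_M[OF v] False by simp
  next
    case True
    define H where "H = cls v"
    have Hc: "H \<in> mg_components F" using cls_comp[OF v] by (simp add: H_def)
    note H_facts = comp_H[OF cls_comp[OF v] self[OF v] v, folded H_def]
    have R_ends: "mends G e \<subseteq> V" if "e \<in> R k" for e
      using that edges_F multigraph_edge(2)[OF mG] by (auto simp: R_def V_def)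
    \<comment> \<open>The class of \<open>v\<close> in \<open>R k\<close> consists of all vertices
      of its component that \<open>R k\<close> meets; the others contribute 0.\<close>
    have "{w \<in> V. linked (mends G) (R k) v w} = {w \<in> mverts H. \<exists>e\<in>R k. w \<in> mends G e}"
    proof (intro set_eqI iffI)
      fix w assume w: "w \<in> {w \<in> V. linked (mends G) (R k) v w}"
      have "linked (mends F) (medges F) v w"
        using w linked_mono[of "mends G" "R k" v w "medges F"] ends_F by (auto simp: R_def)
      then have "w \<in> mverts H" using w span by (simp add: H_def cls_def component_simps V_def)
      moreover have "w \<in> {w. \<exists>e\<in>R k. w \<in> mends G e}"
        by (rule linked_closed[of "mends G" "R k" v]) (use w True in blast)+
      ultimately show "w \<in> {w \<in> mverts H. \<exists>e\<in>R k. w \<in> mends G e}" by blast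
    next
      fix w assume "w \<in> {w \<in> mverts H. \<exists>e\<in>R k. w \<in> mends G e}"
      then obtain f where f: "f \<in> R k" "w \<in> mends G f" "w \<in> mverts H" by blast
      have wV: "w \<in> V" using R_ends f by blast
      have wH: "cls w = H" using comp_H(1)[OF Hc f(3) wV] by simp
      obtain e where e: "e \<in> R k" "v \<in> mends G e" using True by blast
      have e': "e \<in> medges H" "cc' H e \<noteq> k" using R_at[OF v, of k] e by (auto simp: H_def)
      have f': "f \<in> medges H" "cc' H f \<noteq> k" using R_at[OF wV, of k] f wH by auto
      have "linked (mends G) {g \<in> medges H. cc' H g \<noteq> k} v w"
        using good_colouring_connected[OF good'[OF Hc] k e' _ f'] e(2) f(2) H_facts(3) by simp
      moreover have "{g \<in> medges H. cc' H g \<noteq> k} \<subseteq> R k"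
      proof
        fix g assume g: "g \<in> {g \<in> medges H. cc' H g \<noteq> k}"
        then obtain u where u: "u \<in> mends G g"
          using multigraph_edge(4)[OF H_facts(2)] H_facts(3) by auto
        have "u \<in> mverts H" using g u multigraph_edge(2)[OF H_facts(2)] H_facts(3) by auto
        then have "u \<in> V" "cls u = H" using verts_cls[OF Hc] by auto
        then show "g \<in> R k" using R_at[of u k] g u by auto
      qed
      ultimately show "w \<in> {w \<in> V. linked (mends G) (R k) v w}"
        using linked_mono wV by (metis (mono_tags, lifting) mem_Collect_eq)
    qed
    moreover have "(\<Sum>w\<in>{w \<in> mverts H. \<exists>e\<in>R k. w \<in> mends G e}. edeg (mends G) {e \<in> M. \<mu> e = k} w) =
        (\<Sum>w\<in>mverts H. edeg (mends G) {e \<in> M. \<mu> e = k} w)"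
    proof (rule sum.mono_neutral_left)
      show "finite (mverts H)" using H_facts(2) by (simp add: multigraph_def)
      show "\<forall>w\<in>mverts H - {w \<in> mverts H. \<exists>e\<in>R k. w \<in> mends G e}.
          edeg (mends G) {e \<in> M. \<mu> e = k} w = 0"
        using no_M verts_cls[OF Hc] by blast
    qed blast
    moreover have "even (\<Sum>w\<in>mverts H. edeg (mends G) {e \<in> M. \<mu> e = k} w)"
      using balanced[of H k] k Hc comps_V verts_cls[OF Hc] by simp
    ultimately show ?thesis by simp
  qed
  show ?thesis
    by (rule colour_classes_imp_6_cdc[OF cub edges_F, of c \<mu>])
      (use c3 \<mu>(1) even_R par in \<open>auto simp: R_def M_def V_def\<close>)
qed

section \<open>The three conditions\<close>

text \<open>With all cycle components as the core, condition (ii) says that the core is connected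
  and that every Kotzig component has a neighbour in it. Under condition (i) such a neighbour
  exists because \<open>G\<close> is connected: an edge leaving a Kotzig component cannot lead to
  another one.\<close>

theorem corollary6:
  fixes G F :: "('v, 'e) mgraph"
  assumes "cubic_graph G" and "two_connected G" and "kotzig_frame G F"
    and "(mg_independent (contracted G F) (K_vertices F) \<and>
            mg_connected (mg_delete (contracted G F) (K_vertices F))) \<or>
         ((\<forall>x\<in>K_vertices F. \<exists>y\<in>C_vertices F. mg_adjacent (contracted G F) x y) \<and>
            mg_connected (mg_delete (contracted G F) (K_vertices F))) \<or>
         (\<exists>C'. C' \<subseteq> C_vertices F \<and> mg_connected (mg_induced (contracted G F) C') \<and>
            K_vertices F \<subseteq> mg_neighbors (contracted G F) C')"
  shows "has_k_cdc 6 G"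
proof -
  have mG: "multigraph G" using assms(1) by (simp add: cubic_graph_def)
  interpret spanning_subgraph G F
    using mG assms(3) by unfold_locales (simp_all add: kotzig_frame_def)
  define D where "D = mg_components F - K_vertices F"
  have D_C: "D \<subseteq> C_vertices F"
    using assms(3) by (auto simp: D_def kotzig_frame_def K_vertices_def C_vertices_def)
  have delete: "mg_delete (contracted G F) (K_vertices F) = mg_induced (contracted G F) D"
    by (simp add: mg_delete_def contracted_verts D_def)
  have K_comps: "K_vertices F \<subseteq> mg_components F" by (auto simp: K_vertices_def)
  have nbr: "x \<in> mg_neighbors (contracted G F) D"
    if "x \<in> K_vertices F" "y \<in> D" "mg_adjacent (contracted G F) x y" for x y
    using that K_comps unfolding mg_neighbors_def mg_adjacent_def contracted_verts
    by (auto simp: insert_commute)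
  consider
      (indep) "mg_independent (contracted G F) (K_vertices F)" "mg_connected (mg_induced (contracted G F) D)"
    | (adj) "\<forall>x\<in>K_vertices F. \<exists>y\<in>C_vertices F. mg_adjacent (contracted G F) x y"
        "mg_connected (mg_induced (contracted G F) D)"
    | (core) C' where "C' \<subseteq> C_vertices F" "mg_connected (mg_induced (contracted G F) C')"
        "K_vertices F \<subseteq> mg_neighbors (contracted G F) C'"
    using assms(4) unfolding delete by blast
  then show ?thesis
  proof cases
    case core
    then show ?thesis using core_connected_imp_6_cdc[OF assms(1,3)] by blast
  next
    case adj
    have "C_vertices F \<subseteq> D"
      using C_vertices_K_vertices_disjoint[of F] by (auto simp: D_def C_vertices_def)
    then have "K_vertices F \<subseteq> mg_neighbors (contracted G F) D" using adj(1) nbr by blast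
    then show ?thesis using core_connected_imp_6_cdc[OF assms(1,3) D_C adj(2)] by blast
  next
    case indep
    have "K_vertices F \<subseteq> mg_neighbors (contracted G F) D"
    proof
      fix x assume x: "x \<in> K_vertices F"
      then have xc: "x \<in> mg_components F" using K_comps by blast
      obtain y where y: "y \<in> D"
        using indep(2) by (auto simp: mg_connected_def mg_induced_def)
      then have yc: "y \<in> mg_components F" "y \<noteq> x" using x by (auto simp: D_def)
      obtain v w where vw: "v \<in> mverts G" "x = component F v" "w \<in> mverts G" "y = component F w"
        using xc yc(1) comps by blast
      have "linked (mends G) (medges G) v w"
        using assms(2) vw unfolding two_connected_def mg_connected_iff_linked by blast
      moreover have "v \<in> mverts x" "w \<notin> mverts x"
        using in_component_iff[OF xc] vw yc(2) by auto
      ultimately obtain e where e: "e \<in> medges G" "\<not> mends G e \<subseteq> mverts x" "mends G e \<inter> mverts x \<noteq> {}"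
        using linked_closed[of "mends G" "medges G" v w "mverts x"] by blast
      obtain a b where ab: "a \<in> mends G e" "a \<in> mverts x" "b \<in> mends G e" "b \<notin> mverts x"
        using e(2,3) by blast
      have abV: "a \<in> mverts G" "b \<in> mverts G" using ab multigraph_edge(2)[OF mG e(1)] by auto
      have "a \<noteq> b" using ab by blast
      then have ends: "mends G e = {a, b}"
        using ab(1,3) multigraph_edge(1)[OF mG e(1)] by (auto simp: card_2_iff)
      define z where "z = component F b"
      have ax: "component F a = x" and zx: "z \<noteq> x" and zc: "z \<in> mg_components F"
        using in_component_iff[OF xc] abV ab comps by (auto simp: z_def)
      have "e \<in> medges (contracted G F)"
        using e(1) ends ax zx by (auto simp: contracted_edges z_def)
      then have adj: "mg_adjacent (contracted G F) x z"
        using contracted_ends[OF e(1)] ends ax by (auto simp: mg_adjacent_def z_def)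
      then have "z \<notin> K_vertices F" using indep(1) x by (auto simp: mg_independent_def)
      then show "x \<in> mg_neighbors (contracted G F) D"
        using nbr[OF x _ adj] zc by (simp add: D_def)
    qed
    then show ?thesis using core_connected_imp_6_cdc[OF assms(1,3) D_C indep(2)] by blast
  qed
qed

end
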